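(* Let $k$ be a field of characteristic $0$, let $n\ge3$, $S=k[x_1,\dots,x_n]$, and let $F=a_0p_1^3+a_1np_1p_2+a_2n^2p_3\in k[X_1,\dots,X_n]$ be any nonzero symmetric cubic form ($a_0,a_1,a_2\in k$). Then $S/\operatorname{ann}(F)$ satisfies the Strong Lefschetz Property.
   Context: $p_i=\sum_{j=1}^nX_j^i$. $S$ acts on $k[X_1,\dots,X_n]$ with $x_i$ acting as $\partial/\partial X_i$, and $\operatorname{ann}(F)\subseteq S$ is the annihilator of $F$. A graded artinian $k$-algebra $A$ (a quotient of $S$) satisfies the Strong Lefschetz Property if, for a general linear form $\ell$, the multiplication map $\times\ell^j:[A]_i\to[A]_{i+j}$ has maximal rank for all $i\ge0$ and $j\ge0$. *)

theory Defs
  imports "HOL-Library.Poly_Mapping" "HOL-Library.Cardinality"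
    "HOL-Algebra.QuotRing" "HOL-Algebra.Embedded_Algebras"
begin

section \<open>Polynomials in finitely many variables\<close>

text \<open>
  A polynomial maps exponent vectors to coefficients; its variables are indexed by a finite
  type \<open>'n\<close>, so the number of variables is \<open>CARD('n)\<close>.  Multiplication is the convolution product
  supplied by the library.  The same type serves as \<open>S = k[x\<^sub>1,\<dots>,x\<^sub>n]\<close> and as \<open>k[X\<^sub>1,\<dots>,X\<^sub>n]\<close>.
\<close>

type_synonym ('n, 'k) mpol = "('n \<Rightarrow>\<^sub>0 nat) \<Rightarrow>\<^sub>0 'k"

definition mconst :: "'k::zero \<Rightarrow> ('n, 'k) mpol" where
  "mconst c = Poly_Mapping.single 0 c"

definition mvar :: "'n \<Rightarrow> ('n, 'k::zero_neq_one) mpol" where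
  "mvar i = Poly_Mapping.single (Poly_Mapping.single i 1) 1"

definition meval :: "('n::finite \<Rightarrow> 'k) \<Rightarrow> ('n, 'k::comm_semiring_1) mpol \<Rightarrow> 'k" where
  "meval c G = (\<Sum>m \<in> Poly_Mapping.keys G. Poly_Mapping.lookup G m *
     (\<Prod>i\<in>UNIV. c i ^ Poly_Mapping.lookup m i))"

definition homogeneous_part :: "nat \<Rightarrow> ('n::finite, 'k::zero) mpol set" where
  "homogeneous_part d =
     {f. \<forall>m \<in> Poly_Mapping.keys f. (\<Sum>i\<in>UNIV. Poly_Mapping.lookup m i) = d}"

definition linear_form :: "('n::finite \<Rightarrow> 'k) \<Rightarrow> ('n, 'k::comm_semiring_1) mpol" where
  "linear_form c = (\<Sum>i\<in>UNIV. mconst (c i) * mvar i)"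

definition power_sum :: "nat \<Rightarrow> ('n::finite, 'k::comm_semiring_1) mpol" where
  "power_sum d = (\<Sum>j\<in>UNIV. mvar j ^ d)"


section \<open>The action by differentiation and annihilators\<close>

text \<open>
  If the exponent of \<open>X\<^sub>i\<close> in a monomial is \<open>0\<close>, the truncated subtraction below is harmless because
  the coefficient vanishes.
\<close>

definition mderiv :: "'n \<Rightarrow> ('n, 'k::comm_semiring_1) mpol \<Rightarrow> ('n, 'k) mpol" where
  "mderiv i F = (\<Sum>m \<in> Poly_Mapping.keys F.
     Poly_Mapping.single (m - Poly_Mapping.single i 1)
       (of_nat (Poly_Mapping.lookup m i) * Poly_Mapping.lookup F m))"

text \<open>
  The monomial with exponent vector \<open>m\<close> acts as the composition of the operators
  \<open>(\<partial>/\<partial>X\<^sub>i)\<^bsup>m i\<^esup>\<close>; the order of composition is immaterial since these commute.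
\<close>

definition monom_act :: "('n::finite \<Rightarrow>\<^sub>0 nat) \<Rightarrow> ('n, 'k::comm_semiring_1) mpol \<Rightarrow> ('n, 'k) mpol" where
  "monom_act m F = Finite_Set.fold (\<lambda>i. mderiv i ^^ Poly_Mapping.lookup m i) F UNIV"

definition diff_act :: "('n::finite, 'k::comm_semiring_1) mpol \<Rightarrow> ('n, 'k) mpol \<Rightarrow> ('n, 'k) mpol" where
  "diff_act g F = (\<Sum>m \<in> Poly_Mapping.keys g. mconst (Poly_Mapping.lookup g m) * monom_act m F)"

definition ann :: "('n::finite, 'k::comm_semiring_1) mpol \<Rightarrow> ('n, 'k) mpol set" where
  "ann F = {g. diff_act g F = 0}"


section \<open>Graded quotients and the Strong Lefschetz Property\<close>

definition mpol_ring :: "('n, 'k::comm_ring_1) mpol ring" where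
  "mpol_ring = \<lparr>carrier = UNIV, mult = (*), one = 1, zero = 0, add = (+)\<rparr>"

definition quot_part :: "('n::finite, 'k::comm_ring_1) mpol set \<Rightarrow> nat \<Rightarrow> ('n, 'k) mpol set set" where
  "quot_part I d = (\<lambda>f. I +>\<^bsub>mpol_ring\<^esub> f) ` homogeneous_part d"

text \<open>The copy of the ground field \<open>k\<close> in \<open>S/I\<close>, over which dimensions are taken.\<close>

definition quot_scalars :: "('n::finite, 'k::comm_ring_1) mpol set \<Rightarrow> ('n, 'k) mpol set set" where
  "quot_scalars I = range (\<lambda>c. I +>\<^bsub>mpol_ring\<^esub> mconst c)"

definition quot_dim :: "('n::finite, 'k::comm_ring_1) mpol set \<Rightarrow> ('n, 'k) mpol set set \<Rightarrow> nat" where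
  "quot_dim I E = ring.dim (mpol_ring Quot I) (quot_scalars I) E"

definition mult_power_map ::
  "('n::finite, 'k::comm_ring_1) mpol set \<Rightarrow> ('n, 'k) mpol \<Rightarrow> nat \<Rightarrow> ('n, 'k) mpol set \<Rightarrow> ('n, 'k) mpol set" where
  "mult_power_map I l j a =
     ((I +>\<^bsub>mpol_ring\<^esub> l) [^]\<^bsub>mpol_ring Quot I\<^esub> j) \<otimes>\<^bsub>mpol_ring Quot I\<^esub> a"

definition mult_power_max_rank ::
  "('n::finite, 'k::comm_ring_1) mpol set \<Rightarrow> ('n, 'k) mpol \<Rightarrow> nat \<Rightarrow> nat \<Rightarrow> bool" where
  "mult_power_max_rank I l j i \<longleftrightarrow>
     quot_dim I (mult_power_map I l j ` quot_part I i) =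
       min (quot_dim I (quot_part I i)) (quot_dim I (quot_part I (i + j)))"

definition zariski_open :: "('n::finite \<Rightarrow> 'k::comm_semiring_1) set \<Rightarrow> bool" where
  "zariski_open U \<longleftrightarrow> (\<exists>P. U = {c. \<exists>G\<in>P. meval c G \<noteq> 0})"

text \<open>
  The Strong Lefschetz Property of \<open>S/I\<close>, for a homogeneous ideal \<open>I\<close> with artinian quotient.
  A general linear form is one whose coefficient vector lies in some nonempty Zariski-open subset
  of \<open>k\<^sup>n\<close>; one such set has to work for all \<open>i\<close> and \<open>j\<close>.
\<close>

definition strong_lefschetz :: "('n::finite, 'k::field) mpol set \<Rightarrow> bool" where
  "strong_lefschetz I \<longleftrightarrow>
     (\<exists>U. zariski_open U \<and> U \<noteq> {} \<and>
       (\<forall>c\<in>U. \<forall>i j. mult_power_max_rank I (linear_form c) j i))"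

end

theory Submission
  imports Defs "HOL-Analysis.Determinants"
begin

text \<open>
  Scaling coefficients by factorials turns differentiation into contraction, so that \<open>ann F\<close> is the
  largest ideal on which the linear functional \<open>g \<mapsto> (g \<circ> F)(0)\<close> vanishes.  For a cubic form all
  maximal rank conditions follow from two: \<open>F(c) \<noteq> 0\<close>, and the kernel of the Hessian matrix of \<open>F\<close>
  at \<open>c\<close> consists only of vectors killed by the Hessian matrix at every point.  For a symmetric
  cubic the Hessian is a diagonal matrix plus a matrix of rank at most two, and in each case an explicit
  point \<open>c\<close> satisfies both conditions.  The second one then holds on a Zariski-open set, because it is
  expressed by a determinant, except for multiples of \<open>p\<^sub>1\<^sup>3\<close>, where it follows from the first.
\<close>

section \<open>Linear functionals on polynomials\<close>

text \<open>In terms of the moments \<open>mu_i = p_i / n\<close>, \<open>F\<close> is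
  \<open>n^3\<close> times \<open>a0 mu_1^3 + a1 mu_1 mu_2 + a2 mu_3\<close>, so the exceptional
  coefficients do not depend on \<open>n\<close>. They are governed by the third central moment
  \<open>mu_3 - 3 mu_1 mu_2 + 2 mu_1^3\<close>. This form is unchanged when a constant is added to
  all coordinates. Its Hessian therefore kills the constant vectors at every point, and the Hessian
  determinant is the zero polynomial although the form is not a cube. That is the obstacle to a
  purely determinantal argument: adding the all-ones matrix makes the determinant nonzero while
  still controlling the kernel modulo constants. For \<open>n = 2\<close> the third central moment
  vanishes identically. In the proof, \<open>n \<ge> 3\<close> appears as the factor
  \<open>n - 2\<close> in the sum of cubes of a sum-zero test point.\<close>

lemma mpol_eq_sum_single:
  "f = (\<Sum>m\<in>Poly_Mapping.keys f. Poly_Mapping.single m (Poly_Mapping.lookup f m))"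
  by (rule poly_mapping_eqI)
    (auto simp: lookup_sum lookup_single when_def in_keys_iff sum.delta)

text \<open>Reduces an identity that is additive in a polynomial to monomials; bilinear identities
  take two nested inductions.\<close>

lemma mpol_induct [case_names single add]:
  fixes f :: "'a \<Rightarrow>\<^sub>0 'b::comm_monoid_add"
  assumes "\<And>m c. P (Poly_Mapping.single m c)"
    and "\<And>f g. P f \<Longrightarrow> P g \<Longrightarrow> P (f + g)"
  shows "P f"
proof -
  have "P 0" using assms(1)[of undefined 0] by simp
  have "P (\<Sum>m\<in>M. Poly_Mapping.single m (Poly_Mapping.lookup f m))" if "finite M" for M
    using that by induction (auto intro: assms \<open>P 0\<close>)
  from this[OF finite_keys[of f]] show ?thesis
    using mpol_eq_sum_single[of f] by simp
qed

text \<open>The linear functional with prescribed values \<open>w\<close> on the monomials.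
  Evaluation at a point and the functional attached to \<open>F\<close> are both instances, so
  linearity is proved only once.\<close>

definition coeff_pairing :: "('a \<Rightarrow> 'k) \<Rightarrow> ('a \<Rightarrow>\<^sub>0 'k::comm_semiring_1) \<Rightarrow> 'k" where
  "coeff_pairing w f = (\<Sum>m\<in>Poly_Mapping.keys f. Poly_Mapping.lookup f m * w m)"

lemma coeff_pairing_superset:
  assumes "finite M" "Poly_Mapping.keys f \<subseteq> M"
  shows "coeff_pairing w f = (\<Sum>m\<in>M. Poly_Mapping.lookup f m * w m)"
  unfolding coeff_pairing_def using assms
  by (intro sum.mono_neutral_left) (auto simp: in_keys_iff)

lemma coeff_pairing_add: "coeff_pairing w (f + g) = coeff_pairing w f + coeff_pairing w g"
proof -
  let ?M = "Poly_Mapping.keys f \<union> Poly_Mapping.keys g"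
  show ?thesis
    using coeff_pairing_superset[of ?M f w] coeff_pairing_superset[of ?M g w]
      coeff_pairing_superset[of ?M "f + g" w] keys_add[of f g]
    by (simp add: lookup_add distrib_right sum.distrib)
qed

lemma coeff_pairing_single [simp]: "coeff_pairing w (Poly_Mapping.single m c) = c * w m"
  by (simp add: coeff_pairing_def)

lemma coeff_pairing_0 [simp]: "coeff_pairing w 0 = 0"
  by (simp add: coeff_pairing_def)

lemma coeff_pairing_sum: "coeff_pairing w (sum f A) = (\<Sum>i\<in>A. coeff_pairing w (f i))"
  by (induction A rule: infinite_finite_induct) (auto simp: coeff_pairing_add)

lemma coeff_pairing_mconst: "coeff_pairing w (mconst c * f) = c * coeff_pairing w f"
  by (induction f rule: mpol_induct)
    (simp_all add: mconst_def mult_single coeff_pairing_add distrib_left mult.assoc)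

lemma coeff_pairing_diff:
  fixes f g :: "'a \<Rightarrow>\<^sub>0 'k::comm_ring_1"
  shows "coeff_pairing w (f - g) = coeff_pairing w f - coeff_pairing w g"
  using coeff_pairing_add[of w "f - g" g] by simp

lemma meval_eq_pairing:
  "meval c = coeff_pairing (\<lambda>m. \<Prod>i\<in>UNIV. c i ^ Poly_Mapping.lookup m i)"
  by (rule ext) (simp add: meval_def coeff_pairing_def)

lemma meval_add: "meval c (f + g) = meval c f + meval c g"
  by (simp add: meval_eq_pairing coeff_pairing_add)

lemma meval_mult: "meval c (f * g) = meval c f * meval c g"
proof (induction f rule: mpol_induct)
  case (single m a)
  show ?case
    by (induction g rule: mpol_induct)
      (simp_all add: meval_eq_pairing mult_single coeff_pairing_add algebra_simps
        lookup_add power_add prod.distrib)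
qed (simp add: meval_add distrib_right)

lemma meval_mconst [simp]: "meval c (mconst a) = a"
  by (simp add: meval_eq_pairing mconst_def)

lemma meval_0 [simp]: "meval c 0 = 0"
  by (simp add: meval_eq_pairing)

lemma mconst_1: "mconst 1 = 1"
  by (simp add: mconst_def)

lemma mconst_0: "mconst 0 = 0"
  by (simp add: mconst_def)

lemma mconst_mult: "mconst c * mconst d = mconst (c * d)"
  by (simp add: mconst_def mult_single)

lemma mconst_add: "mconst c + mconst d = mconst (c + d)"
  by (simp add: mconst_def single_add)

lemma meval_1 [simp]: "meval c 1 = 1"
  using meval_mconst[of c 1] by (simp add: mconst_1)

lemma meval_mvar [simp]: "meval c (mvar i) = c i"
proof -
  have "(\<Prod>j\<in>UNIV. c j ^ Poly_Mapping.lookup (Poly_Mapping.single i 1) j) = c i"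
    by (subst prod.cong[OF refl, of _ _ "\<lambda>j. if j = i then c i else 1"])
      (auto simp: lookup_single when_def)
  then show ?thesis by (simp add: meval_eq_pairing mvar_def)
qed

lemma meval_power: "meval c (f ^ k) = meval c f ^ k"
  by (induction k) (auto simp: meval_mult)

lemma meval_sum: "meval c (sum f A) = (\<Sum>i\<in>A. meval c (f i))"
  by (simp add: meval_eq_pairing coeff_pairing_sum)

lemma meval_prod: "meval c (prod f A) = (\<Prod>i\<in>A. meval c (f i))"
  by (induction A rule: infinite_finite_induct) (auto simp: meval_mult)

lemma meval_of_nat [simp]: "meval c (of_nat k) = of_nat k"
  by (induction k) (auto simp: meval_add)

lemma meval_numeral [simp]: "meval c (numeral k) = numeral k"
  using meval_of_nat[of c "numeral k"] by simp

lemma meval_of_int [simp]: "meval c (of_int k) = (of_int k :: 'k::comm_ring_1)"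
proof -
  have "meval c (- of_nat m) = (- of_nat m :: 'k)" for m
    using meval_add[of c "- of_nat m" "of_nat m"] by (simp add: eq_neg_iff_add_eq_0)
  then show ?thesis by (cases k) (simp_all del: of_nat_Suc)
qed

lemma meval_power_sum: "meval c (power_sum d) = (\<Sum>j\<in>UNIV. c j ^ d)"
  by (simp add: power_sum_def meval_sum meval_power)

text \<open>Evaluation is a ring homomorphism and a determinant is a polynomial in the entries. This
  turns nondegeneracy of a matrix depending on \<open>c\<close> into the nonvanishing of one
  polynomial at \<open>c\<close>.\<close>

lemma meval_det:
  fixes A :: "('n::finite, 'k::comm_ring_1) mpol ^ 'm ^ 'm"
  shows "meval c (det A) = det (\<chi> i j. meval c (A $ i $ j))"
  by (simp add: det_def meval_sum meval_mult meval_prod)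

section \<open>Homogeneous polynomials\<close>

definition mdegree :: "('n::finite \<Rightarrow>\<^sub>0 nat) \<Rightarrow> nat" where
  "mdegree m = (\<Sum>i\<in>UNIV. Poly_Mapping.lookup m i)"

lemma mdegree_add: "mdegree (m + m') = mdegree m + mdegree m'"
  by (simp add: mdegree_def lookup_add sum.distrib)

lemma mdegree_single [simp]: "mdegree (Poly_Mapping.single i k) = k"
  by (simp add: mdegree_def lookup_single when_def)

lemma mdegree_0 [simp]: "mdegree 0 = 0"
  by (simp add: mdegree_def)

lemma mdegree_eq_0_iff [simp]: "mdegree m = 0 \<longleftrightarrow> m = 0"
  by (auto simp: mdegree_def intro!: poly_mapping_eqI)

lemma homogeneous_part_iff:
  "f \<in> homogeneous_part d \<longleftrightarrow> (\<forall>m. Poly_Mapping.lookup f m \<noteq> 0 \<longrightarrow> mdegree m = d)"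
  by (auto simp: homogeneous_part_def mdegree_def in_keys_iff)

lemma homogeneous_part_single: "mdegree m = d \<Longrightarrow> Poly_Mapping.single m c \<in> homogeneous_part d"
  by (auto simp: homogeneous_part_iff lookup_single when_def)

lemma homogeneous_part_0: "0 \<in> homogeneous_part d"
  by (simp add: homogeneous_part_iff)

lemma homogeneous_part_add:
  fixes f g :: "('n::finite, 'k::comm_monoid_add) mpol"
  assumes "f \<in> homogeneous_part d" "g \<in> homogeneous_part d"
  shows "f + g \<in> homogeneous_part d"
  using assms by (auto simp: homogeneous_part_iff lookup_add) (metis add_0)

lemma homogeneous_part_sum:
  fixes f :: "'a \<Rightarrow> ('n::finite, 'k::comm_monoid_add) mpol"
  shows "(\<And>i. i \<in> A \<Longrightarrow> f i \<in> homogeneous_part d) \<Longrightarrow> sum f A \<in> homogeneous_part d"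
  by (induction A rule: infinite_finite_induct)
    (auto simp: homogeneous_part_0 homogeneous_part_add)

lemma homogeneous_part_mult:
  fixes f g :: "('n::finite, 'k::comm_semiring_1) mpol"
  assumes "f \<in> homogeneous_part d" "g \<in> homogeneous_part e"
  shows "f * g \<in> homogeneous_part (d + e)"
  unfolding homogeneous_part_def
proof safe
  fix m assume "m \<in> Poly_Mapping.keys (f * g)"
  then obtain a b where "m = a + b" "a \<in> Poly_Mapping.keys f" "b \<in> Poly_Mapping.keys g"
    using keys_mult[of f g] by blast
  then have "mdegree m = d + e"
    using assms by (auto simp: homogeneous_part_iff mdegree_add in_keys_iff)
  then show "(\<Sum>i\<in>UNIV. Poly_Mapping.lookup m i) = d + e" by (simp add: mdegree_def)
qed

lemma homogeneous_part_mconst: "mconst c \<in> homogeneous_part 0"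
  by (simp add: mconst_def homogeneous_part_single)

lemma homogeneous_part_mconst_mult:
  fixes f :: "('n::finite, 'k::comm_semiring_1) mpol"
  shows "f \<in> homogeneous_part d \<Longrightarrow> mconst c * f \<in> homogeneous_part d"
  using homogeneous_part_mult[OF homogeneous_part_mconst] by fastforce

lemma homogeneous_part_mvar: "mvar i \<in> homogeneous_part 1"
  by (simp add: mvar_def homogeneous_part_single)

lemma homogeneous_part_power:
  fixes f :: "('n::finite, 'k::comm_semiring_1) mpol"
  assumes "f \<in> homogeneous_part d" shows "f ^ k \<in> homogeneous_part (k * d)"
proof (induction k)
  case 0
  show ?case using homogeneous_part_mconst[of "1::'k"] by (simp add: mconst_1)
qed (use homogeneous_part_mult[OF assms] in auto)

lemma homogeneous_part_linear_form: "linear_form c \<in> homogeneous_part 1"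
  unfolding linear_form_def
  by (intro homogeneous_part_sum homogeneous_part_mconst_mult homogeneous_part_mvar)

lemma homogeneous_part_power_sum: "power_sum d \<in> homogeneous_part d"
  unfolding power_sum_def
  by (intro homogeneous_part_sum) (use homogeneous_part_power[OF homogeneous_part_mvar, of _ d] in simp)

lemma mdegree_Suc_split:
  assumes "mdegree m = Suc d"
  obtains i m' where "m = Poly_Mapping.single i 1 + m'" "mdegree m' = d"
proof -
  obtain i where i: "Poly_Mapping.lookup m i \<noteq> 0"
    using assms by (metis mdegree_eq_0_iff nat.distinct(1) poly_mapping_eqI lookup_zero)
  have eq: "m = Poly_Mapping.single i 1 + (m - Poly_Mapping.single i 1)"
    using i by (intro poly_mapping_eqI) (auto simp: lookup_add lookup_minus lookup_single when_def)
  then have "mdegree (m - Poly_Mapping.single i 1) = d"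
    using assms mdegree_add[of "Poly_Mapping.single i 1" "m - Poly_Mapping.single i 1"] by simp
  with eq show ?thesis by (rule that)
qed

text \<open>Needed for the graded pieces of the quotient to be finite-dimensional, so that the
  dimensions in the rank condition are meaningful.\<close>

lemma finite_mdegree: "finite {m :: 'n::finite \<Rightarrow>\<^sub>0 nat. mdegree m = d}"
proof (induction d)
  case (Suc d)
  have "{m :: 'n \<Rightarrow>\<^sub>0 nat. mdegree m = Suc d} \<subseteq>
     (\<lambda>(i, m). Poly_Mapping.single i 1 + m) ` (UNIV \<times> {m. mdegree m = d})"
    by (force elim!: mdegree_Suc_split)
  moreover have "finite ((\<lambda>(i::'n, m). Poly_Mapping.single i 1 + m) ` (UNIV \<times> {m. mdegree m = d}))"
    using Suc by simp
  ultimately show ?case by (rule finite_subset)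
qed auto

lemma homogeneous_part_1_linear_form:
  fixes g :: "('n::finite, 'k::comm_semiring_1) mpol"
  assumes "g \<in> homogeneous_part 1"
  obtains v where "g = linear_form v"
proof
  let ?e = "\<lambda>i::'n. Poly_Mapping.single i (1::nat)"
  have inj: "?e i = ?e j \<longleftrightarrow> i = j" for i j
    by (metis lookup_single_eq lookup_single_not_eq one_neq_zero)
  show "g = linear_form (\<lambda>i. Poly_Mapping.lookup g (?e i))"
  proof (rule poly_mapping_eqI)
    fix m
    have rhs: "Poly_Mapping.lookup (linear_form (\<lambda>i. Poly_Mapping.lookup g (?e i))) m
        = (\<Sum>i\<in>UNIV. (Poly_Mapping.lookup g (?e i) when ?e i = m))"
      by (simp add: linear_form_def lookup_sum mconst_def mvar_def mult_single lookup_single)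
    show "Poly_Mapping.lookup g m =
        Poly_Mapping.lookup (linear_form (\<lambda>i. Poly_Mapping.lookup g (?e i))) m"
    proof (cases "mdegree m = 1")
      case True
      then obtain i where "m = ?e i"
        by (metis One_nat_def add.right_neutral mdegree_Suc_split mdegree_eq_0_iff)
      then show ?thesis unfolding rhs by (simp add: inj when_def del: One_nat_def)
    next
      case False
      then have "?e i \<noteq> m" for i by auto
      then show ?thesis using False assms unfolding rhs homogeneous_part_iff by auto
    qed
  qed
qed

section \<open>The action by differentiation as a contraction\<close>

text \<open>The coefficient of \<open>F\<close> in the divided power basis
  \<open>X^m / m!\<close>.\<close>

definition fact_coeff :: "('n::finite, 'k::comm_semiring_1) mpol \<Rightarrow> ('n \<Rightarrow>\<^sub>0 nat) \<Rightarrow> 'k" where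
  "fact_coeff F m = of_nat (\<Prod>i\<in>UNIV. fact (Poly_Mapping.lookup m i)) * Poly_Mapping.lookup F m"

lemma fact_coeff_eq_0_iff [simp]:
  fixes F :: "('n::finite, 'k::field_char_0) mpol"
  shows "fact_coeff F m = 0 \<longleftrightarrow> Poly_Mapping.lookup F m = 0"
  by (simp add: fact_coeff_def)

lemma fact_coeff_inject:
  fixes F G :: "('n::finite, 'k::field_char_0) mpol"
  assumes "\<And>m. fact_coeff F m = fact_coeff G m" shows "F = G"
  using assms by (intro poly_mapping_eqI) (simp add: fact_coeff_def)

lemma lookup_mderiv:
  "Poly_Mapping.lookup (mderiv i F) m =
     of_nat (Suc (Poly_Mapping.lookup m i)) * Poly_Mapping.lookup F (m + Poly_Mapping.single i 1)"
proof -
  let ?e = "Poly_Mapping.single i (1::nat)"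
  \<comment> \<open>Truncated subtraction is not injective: if \<open>m\<close> has exponent 0 at
    \<open>i\<close>, then \<open>k = m\<close> also satisfies \<open>k - ?e = m\<close>. That term
    carries the factor 0, so only \<open>k = m + ?e\<close> contributes.\<close>
  have eq: "(of_nat (Poly_Mapping.lookup k i) * Poly_Mapping.lookup F k when k - ?e = m)
     = (if k = m + ?e then of_nat (Suc (Poly_Mapping.lookup m i)) * Poly_Mapping.lookup F (m + ?e) else 0)"
    for k
  proof (cases "Poly_Mapping.lookup k i = 0")
    case True
    then have "k \<noteq> m + ?e" by (auto simp: lookup_add)
    with True show ?thesis by simp
  next
    case False
    then have "k = (k - ?e) + ?e"
      by (intro poly_mapping_eqI) (auto simp: lookup_add lookup_minus lookup_single when_def)
    then have "k - ?e = m \<longleftrightarrow> k = m + ?e" by (metis add_diff_cancel_right')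
    then show ?thesis by (auto simp: when_def lookup_add)
  qed
  show ?thesis
    by (simp add: mderiv_def lookup_sum lookup_single eq sum.delta' in_keys_iff flip: One_nat_def)
qed

text \<open>The factor \<open>m i + 1\<close> produced by differentiation completes the factorial of
  \<open>m i\<close> to that of \<open>m i + 1\<close>. In divided powers a derivative is thus a
  pure index shift.\<close>

lemma fact_coeff_mderiv: "fact_coeff (mderiv i F) m = fact_coeff F (m + Poly_Mapping.single i 1)"
proof -
  let ?e = "Poly_Mapping.single i (1::nat)"
  have "(\<Prod>j\<in>UNIV. fact (Poly_Mapping.lookup (m + ?e) j) :: nat) =
     (\<Prod>j\<in>UNIV. (if j = i then Suc (Poly_Mapping.lookup m i) else 1) * fact (Poly_Mapping.lookup m j))"
    by (intro prod.cong) (auto simp: lookup_add lookup_single when_def)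
  also have "\<dots> = Suc (Poly_Mapping.lookup m i) * (\<Prod>j\<in>UNIV. fact (Poly_Mapping.lookup m j))"
    by (simp add: prod.distrib)
  finally show ?thesis
    unfolding fact_coeff_def lookup_mderiv by (simp only: of_nat_mult mult_ac)
qed

lemma fact_coeff_mderiv_funpow:
  "fact_coeff ((mderiv i ^^ p) F) m = fact_coeff F (m + Poly_Mapping.single i p)"
  by (induction p arbitrary: m)
    (simp_all add: fact_coeff_mderiv add.assoc flip: single_add)

lemma fact_coeff_monom_act:
  fixes F :: "('n::finite, 'k::field_char_0) mpol"
  shows "fact_coeff (monom_act m F) k = fact_coeff F (k + m)"
proof -
  let ?D = "\<lambda>i. (mderiv i :: ('n, 'k) mpol \<Rightarrow> _) ^^ Poly_Mapping.lookup m i"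
  \<comment> \<open>The fold is determined only for commuting operators. Index shifts commute, and
    in characteristic 0 the scaled coefficients determine the polynomial.\<close>
  interpret comp_fun_commute ?D
    by unfold_locales
      (rule ext, rule fact_coeff_inject, simp add: fact_coeff_mderiv_funpow add_ac)
  have "fact_coeff (Finite_Set.fold ?D F A) k =
     fact_coeff F (k + (\<Sum>i\<in>A. Poly_Mapping.single i (Poly_Mapping.lookup m i)))" if "finite A" for A k
    using that by (induction A arbitrary: k) (auto simp: fact_coeff_mderiv_funpow add_ac)
  moreover have "(\<Sum>i\<in>UNIV. Poly_Mapping.single i (Poly_Mapping.lookup m i)) = m"
    by (rule poly_mapping_eqI) (simp add: lookup_sum lookup_single when_def)
  ultimately show ?thesis by (simp add: monom_act_def)
qed

definition dual_functional :: "('n::finite, 'k::comm_semiring_1) mpol \<Rightarrow> ('n, 'k) mpol \<Rightarrow> 'k" where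
  "dual_functional F = coeff_pairing (fact_coeff F)"

lemma dual_functional_single_mult:
  "dual_functional F (Poly_Mapping.single k c * g) = c * coeff_pairing (\<lambda>m. fact_coeff F (k + m)) g"
  by (induction g rule: mpol_induct)
    (simp_all add: dual_functional_def mult_single coeff_pairing_add distrib_left mult.assoc)

text \<open>Each scaled coefficient of \<open>g\<close> acting on \<open>F\<close> is the constant
  term of a monomial multiple of \<open>g\<close> acting on \<open>F\<close>. This is why testing
  the functional on all multiples of \<open>g\<close> detects membership in
  \<open>ann F\<close>.\<close>

lemma fact_coeff_diff_act:
  fixes F g :: "('n::finite, 'k::field_char_0) mpol"
  shows "fact_coeff (diff_act g F) k = dual_functional F (Poly_Mapping.single k 1 * g)"
proof -
  have lookup_mconst: "Poly_Mapping.lookup (mconst c * f) k = c * Poly_Mapping.lookup f k" for c :: 'k and f :: "('n, 'k) mpol"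
    by (induction f rule: mpol_induct)
      (auto simp: mconst_def mult_single distrib_left lookup_add lookup_single when_def)
  have "fact_coeff (diff_act g F) k = 
      (\<Sum>m\<in>Poly_Mapping.keys g. Poly_Mapping.lookup g m * fact_coeff (monom_act m F) k)"
    by (simp add: fact_coeff_def diff_act_def lookup_sum lookup_mconst sum_distrib_left
        mult.left_commute)
  then show ?thesis
    by (simp add: dual_functional_single_mult fact_coeff_monom_act coeff_pairing_def)
qed

text \<open>Macaulay's inverse system, in terms of a single functional.\<close>

lemma ann_iff_dual_functional:
  fixes F g :: "('n::finite, 'k::field_char_0) mpol"
  shows "g \<in> ann F \<longleftrightarrow> (\<forall>h. dual_functional F (h * g) = 0)"
proof
  assume "g \<in> ann F"
  then have *: "dual_functional F (Poly_Mapping.single k 1 * g) = 0" for k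
    by (simp add: ann_def fact_coeff_def flip: fact_coeff_diff_act)
  show "\<forall>h. dual_functional F (h * g) = 0"
  proof
    fix h show "dual_functional F (h * g) = 0"
    proof (induction h rule: mpol_induct)
      case (single m c)
      then show ?case using *[of m] by (simp add: dual_functional_single_mult)
    qed (simp add: distrib_right dual_functional_def coeff_pairing_add)
  qed
next
  assume "\<forall>h. dual_functional F (h * g) = 0"
  then have "fact_coeff (diff_act g F) k = fact_coeff 0 k" for k
    by (simp add: fact_coeff_diff_act)
  then show "g \<in> ann F" by (simp add: ann_def fact_coeff_inject)
qed

lemma dual_functional_add: "dual_functional F (f + g) = dual_functional F f + dual_functional F g"
  by (simp add: dual_functional_def coeff_pairing_add)

lemma dual_functional_sum: "dual_functional F (sum f A) = (\<Sum>i\<in>A. dual_functional F (f i))"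
  by (simp add: dual_functional_def coeff_pairing_sum)

lemma dual_functional_mconst: "dual_functional F (mconst c * f) = c * dual_functional F f"
  by (simp add: dual_functional_def coeff_pairing_mconst)

lemma dual_functional_diff:
  fixes F f g :: "('n::finite, 'k::comm_ring_1) mpol"
  shows "dual_functional F (f - g) = dual_functional F f - dual_functional F g"
  by (simp add: dual_functional_def coeff_pairing_diff)

lemma dual_functional_eq_0:
  fixes F g :: "('n::finite, 'k::field_char_0) mpol"
  assumes "F \<in> homogeneous_part d" "g \<in> homogeneous_part e" "d \<noteq> e"
  shows "dual_functional F g = 0"
  unfolding dual_functional_def coeff_pairing_def
proof (rule sum.neutral, rule ballI)
  fix m
  show "Poly_Mapping.lookup g m * fact_coeff F m = 0"
    using assms by (auto simp: homogeneous_part_iff)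
qed

text \<open>Different degrees pair to zero, so only monomials of complementary degree have to be
  tested. The degree condition is written as a sum and not as \<open>d - e\<close>, so that it is
  void for \<open>e > d\<close>: forms of degree above \<open>d\<close> then lie in
  \<open>ann F\<close> without any test.\<close>

lemma ann_homogeneousI:
  fixes F g :: "('n::finite, 'k::field_char_0) mpol"
  assumes "F \<in> homogeneous_part d" "g \<in> homogeneous_part e"
    and "\<And>m. mdegree m + e = d \<Longrightarrow> dual_functional F (Poly_Mapping.single m 1 * g) = 0"
  shows "g \<in> ann F"
  unfolding ann_iff_dual_functional
proof
  fix h show "dual_functional F (h * g) = 0"
  proof (induction h rule: mpol_induct)
    case (single m c)
    have "dual_functional F (Poly_Mapping.single m 1 * g) = 0"
    proof (cases "mdegree m + e = d")
      case False
      then show ?thesis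
        using dual_functional_eq_0[OF assms(1) homogeneous_part_mult[OF homogeneous_part_single assms(2)]]
        by metis
    qed (rule assms(3))
    then show ?case by (simp add: dual_functional_single_mult)
  qed (simp add: distrib_right dual_functional_add)
qed

section \<open>Rules for computing partial derivatives\<close>

lemma mderiv_add: "mderiv i (f + g) = mderiv i f + mderiv i g"
  by (rule poly_mapping_eqI) (simp add: lookup_mderiv lookup_add distrib_left)

lemma mderiv_0 [simp]: "mderiv i 0 = 0"
  by (simp add: mderiv_def)

lemma mderiv_single:
  "mderiv i (Poly_Mapping.single m c) =
     Poly_Mapping.single (m - Poly_Mapping.single i 1) (of_nat (Poly_Mapping.lookup m i) * c)"
  by (cases "c = 0") (simp_all add: mderiv_def)

lemma mderiv_mult: "mderiv i (f * g) = mderiv i f * g + f * mderiv i g"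
proof (induction f rule: mpol_induct)
  case (single m a)
  show ?case
  proof (induction g rule: mpol_induct)
    case (single k b)
    let ?e = "Poly_Mapping.single i (1::nat)"
    have *: "Poly_Mapping.single (p + q - ?e) (of_nat (Poly_Mapping.lookup p i) * x) =
       Poly_Mapping.single (p - ?e + q) (of_nat (Poly_Mapping.lookup p i) * x)" for p q x
    proof (cases "Poly_Mapping.lookup p i = 0")
      case False
      then have "p + q - ?e = p - ?e + q"
        by (intro poly_mapping_eqI) (auto simp: lookup_add lookup_minus lookup_single when_def)
      then show ?thesis by simp
    qed simp
    show ?case
      using *[of m k "a * b"] *[of k m "a * b"]
      by (simp add: mderiv_single mult_single lookup_add single_add algebra_simps)
  qed (simp add: mderiv_add distrib_left add_ac)
qed (simp add: mderiv_add distrib_right add_ac)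

lemma mderiv_mconst [simp]: "mderiv i (mconst c) = 0"
  by (simp add: mconst_def mderiv_single)

lemma mderiv_mvar: "mderiv i (mvar j) = (if i = j then 1 else 0)"
  by (simp add: mvar_def mderiv_single lookup_single when_def)

lemma mderiv_sum: "mderiv i (sum f A) = (\<Sum>j\<in>A. mderiv i (f j))"
  by (induction A rule: infinite_finite_induct) (simp_all add: mderiv_add)

text \<open>Three index shifts starting at exponent 0. The values of the functional on cubic
  monomials can thus be computed by differentiating; for a cubic \<open>F\<close> these third
  derivatives are constants.\<close>

lemma dual_functional_mvar_cube:
  fixes F :: "('n::finite, 'k::comm_semiring_1) mpol"
  shows "dual_functional F (mvar i * (mvar j * mvar k)) = 
    Poly_Mapping.lookup (mderiv i (mderiv j (mderiv k F))) 0"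
proof -
  have "Poly_Mapping.lookup G 0 = fact_coeff G 0" for G :: "('n, 'k) mpol"
    by (simp add: fact_coeff_def)
  then show ?thesis
    by (simp add: fact_coeff_mderiv dual_functional_def mvar_def mult_single add_ac)
qed

section \<open>Ranks of multiplication maps\<close>

context ring
begin

lemma line_extension_superset:
  assumes "subfield K R" "dimension n K E" "v \<in> carrier R"
  shows "E \<subseteq> line_extension K v E" "v \<in> line_extension K v E"
proof -
  note K = subringE[OF subfieldE(1)[OF assms(1)]]
  note E = space_subgroup_props[OF assms(1,2)]
  show "E \<subseteq> line_extension K v E"
  proof
    fix e assume "e \<in> E"
    then have "e = \<zero> \<otimes> v \<oplus> e" using E(1) assms(3) by auto
    with \<open>e \<in> E\<close> K(2) show "e \<in> line_extension K v E"
      unfolding line_extension_mem_iff by blast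
  qed
  have "v = \<one> \<otimes> v \<oplus> \<zero>" using assms(3) by simp
  with K(3) E(2) show "v \<in> line_extension K v E"
    unfolding line_extension_mem_iff by blast
qed

lemma line_extension_absorb:
  assumes "subfield K R" "dimension n K E" "v \<in> E"
  shows "line_extension K v E = E"
proof
  show "line_extension K v E \<subseteq> E"
    using space_subgroup_props[OF assms(1,2)] assms(3) by (auto simp: line_extension_mem_iff)
  show "E \<subseteq> line_extension K v E"
    using line_extension_superset(1)[OF assms(1,2)] space_subgroup_props(1)[OF assms(1,2)] assms(3)
    by blast
qed

lemma dimension_line_extension:
  assumes "subfield K R" "dimension n K E" "v \<in> carrier R"
  obtains m where "m \<le> Suc n" "dimension m K (line_extension K v E)"
proof (cases "v \<in> E")
  case True
  then show ?thesis using that[of n] line_extension_absorb[OF assms(1,2)] assms(2) by simp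
next
  case False
  then show ?thesis using that[of "Suc n"] Suc_dim assms by simp
qed

lemma dimension_mono:
  assumes "subfield K R" "dimension m K V" "dimension n K E" "V \<subseteq> E"
  shows "m \<le> n"
proof -
  obtain Us where Us: "set Us \<subseteq> carrier R" "independent K Us" "length Us = m" "Span K Us = V"
    using exists_base[OF assms(1,2)] by auto
  then have "set Us \<subseteq> E" using Span_base_incl[OF assms(1)] assms(4) by blast
  then show ?thesis using independent_length_le_dimension[OF assms(1,3) Us(2)] Us(3) by simp
qed

end

context cring
begin

text \<open>The predicate \<open>dimension\<close> builds a space by adding one line at a time.
  Multiplication by \<open>a\<close> commutes with this step, so dimensions of images can be found
  by induction along it.\<close>

lemma mult_image_line_extension:
  assumes "K \<subseteq> carrier R" "E \<subseteq> carrier R" "a \<in> carrier R" "v \<in> carrier R"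
  shows "(\<otimes>) a ` line_extension K v E = line_extension K (a \<otimes> v) ((\<otimes>) a ` E)"
proof -
  have *: "a \<otimes> (k \<otimes> v \<oplus> e) = k \<otimes> (a \<otimes> v) \<oplus> a \<otimes> e" if "k \<in> K" "e \<in> E" for k e
    using that assms by (auto simp: subset_iff r_distr m_lcomm)
  show ?thesis
    unfolding set_eq_iff line_extension_mem_iff image_iff Bex_def using * by metis
qed

lemma dimension_mult_image_le:
  assumes "dimension n K E" "subfield K R" "a \<in> carrier R"
  shows "\<exists>m\<le>n. dimension m K ((\<otimes>) a ` E)"
  using assms
proof (induction rule: dimension.induct)
  case (zero_dim K)
  then show ?case by auto
next
  case (Suc_dim v E n K)
  then obtain m where m: "m \<le> n" "dimension m K ((\<otimes>) a ` E)" by auto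
  obtain m' where m': "m' \<le> Suc m" "dimension m' K (line_extension K (a \<otimes> v) ((\<otimes>) a ` E))"
    using dimension_line_extension[OF Suc_dim.prems(1) m(2), of "a \<otimes> v"] Suc_dim by auto
  moreover have "(\<otimes>) a ` line_extension K v E = line_extension K (a \<otimes> v) ((\<otimes>) a ` E)"
    using mult_image_line_extension subfieldE(3) space_subgroup_props(1) Suc_dim by metis
  ultimately show ?case using m(1) by (metis Suc_le_mono le_trans)
qed

lemma dimension_mult_image_inj:
  assumes "dimension n K E" "subfield K R" "a \<in> carrier R" "inj_on ((\<otimes>) a) E"
  shows "dimension n K ((\<otimes>) a ` E)"
  using assms
proof (induction rule: dimension.induct)
  case (zero_dim K)
  then show ?case by auto
next
  case (Suc_dim v E n K)
  note sup = line_extension_superset[OF \<open>subfield K R\<close> \<open>dimension n K E\<close> \<open>v \<in> carrier R\<close>]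
  have "a \<otimes> v \<notin> (\<otimes>) a ` E"
    using Suc_dim.prems(3) Suc_dim.hyps(2) sup by (auto dest!: inj_onD)
  moreover have "inj_on ((\<otimes>) a) E" using Suc_dim.prems(3) sup(1) by (rule inj_on_subset)
  moreover have "(\<otimes>) a ` line_extension K v E = line_extension K (a \<otimes> v) ((\<otimes>) a ` E)"
    using mult_image_line_extension subfieldE(3) space_subgroup_props(1) Suc_dim by metis
  ultimately show ?case using Suc_dim by (auto intro: dimension.Suc_dim)
qed

text \<open>An injective multiplication gives an image of the dimension of \<open>E\<close> inside
  \<open>E'\<close>. A surjective one gives \<open>E'\<close> itself, and an image is never larger
  than its source.\<close>

lemma dim_mult_image_eq_min:
  assumes K: "subfield K R" and a: "a \<in> carrier R"
    and fin: "finite_dimension K E" "finite_dimension K E'"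
    and sub: "(\<otimes>) a ` E \<subseteq> E'"
    and inj_or_surj: "inj_on ((\<otimes>) a) E \<or> (\<otimes>) a ` E = E'"
  shows "dim K ((\<otimes>) a ` E) = min (dim K E) (dim K E')"
proof -
  obtain n n' where n: "dimension n K E" "dimension n' K E'"
    using fin by (auto simp: finite_dimension_def)
  have dim: "dim K X = k" if "dimension k K X" for X k
    using dimI[OF K that] by (simp add: over_def)
  from inj_or_surj show ?thesis
  proof
    assume "inj_on ((\<otimes>) a) E"
    then have m: "dimension n K ((\<otimes>) a ` E)" using dimension_mult_image_inj n(1) K a by blast
    then have "n \<le> n'" using dimension_mono[OF K _ n(2) sub] by blast
    then show ?thesis using dim m n by simp
  next
    assume eq: "(\<otimes>) a ` E = E'"
    obtain m where "m \<le> n" "dimension m K E'"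
      using dimension_mult_image_le[OF n(1) K a] eq by auto
    then show ?thesis using dim n eq by (metis min.absorb2)
  qed
qed

end

section \<open>Graded quotients of the polynomial ring\<close>

lemma mpol_ring_simps [simp]:
  "carrier mpol_ring = UNIV" "x \<otimes>\<^bsub>mpol_ring\<^esub> y = x * y" "x \<oplus>\<^bsub>mpol_ring\<^esub> y = x + y"
  "\<one>\<^bsub>mpol_ring\<^esub> = 1" "\<zero>\<^bsub>mpol_ring\<^esub> = 0"
  by (simp_all add: mpol_ring_def)

lemma cring_mpol_ring: "cring (mpol_ring :: ('n, 'k::comm_ring_1) mpol ring)"
proof (rule cringI)
  show "abelian_group (mpol_ring :: ('n, 'k) mpol ring)"
    by (rule abelian_groupI) (auto simp: add_ac intro: exI[of _ "- x" for x])
  show "comm_monoid (mpol_ring :: ('n, 'k) mpol ring)"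
    by (rule comm_monoidI) (auto simp: mult_ac)
qed (simp add: distrib_right)

lemma mpol_ring_minus [simp]:
  fixes x y :: "('n, 'k::comm_ring_1) mpol"
  shows "x \<ominus>\<^bsub>mpol_ring\<^esub> y = x - y"
proof -
  interpret cring "mpol_ring :: ('n, 'k) mpol ring" by (rule cring_mpol_ring)
  have "\<ominus>\<^bsub>mpol_ring\<^esub> y = - y" by (rule minus_equality) auto
  then show ?thesis by (simp add: a_minus_def)
qed

text \<open>Properness of \<open>I\<close> keeps 0 and 1 distinct in the quotient, so that the image
  of the constants is a field over which dimensions can be taken.\<close>

locale mpol_quotient =
  fixes I :: "('n::finite, 'k::field) mpol set"
  assumes ideal_I: "ideal I mpol_ring" and one_notin: "1 \<notin> I"
begin

abbreviation Q where "Q \<equiv> mpol_ring Quot I"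

definition cls :: "('n, 'k) mpol \<Rightarrow> ('n, 'k) mpol set" where
  "cls f = I +>\<^bsub>mpol_ring\<^esub> f"

sublocale R: cring "mpol_ring :: ('n, 'k) mpol ring" by (rule cring_mpol_ring)
sublocale I: ideal I mpol_ring by (rule ideal_I)
sublocale Q: cring Q by (rule I.quotient_is_cring[OF cring_mpol_ring])
sublocale hom: ring_hom_ring mpol_ring Q cls
  using I.rcos_ring_hom_ring unfolding cls_def[abs_def] .

lemma cls_eq_iff: "cls f = cls g \<longleftrightarrow> f - g \<in> I"
  using R.quotient_eq_iff_same_a_r_cos[OF ideal_I, of f g] by (simp add: cls_def)

lemma cls_in_carrier: "cls f \<in> carrier Q"
  using hom.hom_closed[of f] by simp

lemma cls_mult: "cls f \<otimes>\<^bsub>Q\<^esub> cls g = cls (f * g)"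
  using hom.hom_mult[of f g] by simp

lemma cls_add: "cls f \<oplus>\<^bsub>Q\<^esub> cls g = cls (f + g)"
  using hom.hom_add[of f g] by simp

lemma cls_zero: "\<zero>\<^bsub>Q\<^esub> = cls 0" and cls_one: "\<one>\<^bsub>Q\<^esub> = cls 1"
  using hom.hom_zero hom.hom_one by simp_all

lemma cls_power: "cls f [^]\<^bsub>Q\<^esub> (j::nat) = cls (f ^ j)"
  by (induction j) (simp_all add: cls_one cls_mult mult.commute)

lemma mult_power_map_cls: "mult_power_map I l j = (\<otimes>\<^bsub>Q\<^esub>) (cls (l ^ j))"
  by (rule ext) (simp add: mult_power_map_def cls_power flip: cls_def)

lemma quot_part_eq: "quot_part I d = cls ` homogeneous_part d"
  by (simp add: quot_part_def cls_def)

lemma quot_scalars_eq: "quot_scalars I = range (\<lambda>c. cls (mconst c))"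
  by (simp add: quot_scalars_def cls_def)

lemma subfield_quot_scalars: "subfield (quot_scalars I) Q"
proof (rule Q.subfieldI)
  have minus: "\<ominus>\<^bsub>Q\<^esub> cls (mconst c) = cls (mconst (- c))" for c
    by (rule Q.minus_equality) (simp_all add: cls_add cls_zero cls_in_carrier mconst_add mconst_0)
  show "subcring (quot_scalars I) Q"
  proof (rule Q.subcringI'[OF Q.subringI])
    show "\<one>\<^bsub>Q\<^esub> \<in> quot_scalars I"
      unfolding quot_scalars_eq cls_one using mconst_1 by (metis rangeI)
  qed (auto simp: quot_scalars_eq cls_in_carrier minus cls_mult cls_add mconst_mult mconst_add)
  have ne: "cls 1 \<noteq> cls 0" using one_notin by (simp add: cls_eq_iff)
  show "Units (Q\<lparr>carrier := quot_scalars I\<rparr>) = quot_scalars I - {\<zero>\<^bsub>Q\<^esub>}"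
  proof
    show "Units (Q\<lparr>carrier := quot_scalars I\<rparr>) \<subseteq> quot_scalars I - {\<zero>\<^bsub>Q\<^esub>}"
      using ne by (auto simp: Units_def quot_scalars_eq cls_mult cls_one cls_zero)
    show "quot_scalars I - {\<zero>\<^bsub>Q\<^esub>} \<subseteq> Units (Q\<lparr>carrier := quot_scalars I\<rparr>)"
    proof
      fix x assume x: "x \<in> quot_scalars I - {\<zero>\<^bsub>Q\<^esub>}"
      then obtain c where c: "x = cls (mconst c)" by (auto simp: quot_scalars_eq)
      have "c \<noteq> 0" using x c by (auto simp: cls_zero mconst_0)
      then have "cls (mconst c) \<otimes>\<^bsub>Q\<^esub> cls (mconst (inverse c)) = \<one>\<^bsub>Q\<^esub>"
        by (simp add: cls_mult cls_one mconst_mult mconst_1)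
      moreover from this have "cls (mconst (inverse c)) \<otimes>\<^bsub>Q\<^esub> cls (mconst c) = \<one>\<^bsub>Q\<^esub>"
        by (simp add: cls_mult mult.commute)
      ultimately show "x \<in> Units (Q\<lparr>carrier := quot_scalars I\<rparr>)"
        using x c by (auto simp: Units_def quot_scalars_eq)
    qed
  qed
qed

text \<open>Each further monomial extends the space of classes by one line. Its class may already
  lie in the space, so the dimension need not grow; only finiteness is claimed.\<close>

lemma finite_dimension_cls_keys:
  assumes "finite M"
  shows "Q.finite_dimension (quot_scalars I) (cls ` {f. Poly_Mapping.keys f \<subseteq> M})"
  using assms
proof induction
  case empty
  have "cls ` {f. Poly_Mapping.keys f \<subseteq> {}} = {\<zero>\<^bsub>Q\<^esub>}" by (simp add: cls_zero)
  then show ?case using Q.zero_dim Q.finite_dimensionI by metis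
next
  case (insert m M)
  let ?E = "cls ` {f. Poly_Mapping.keys f \<subseteq> M}" and ?v = "cls (Poly_Mapping.single m 1)"
  have mono: "mconst c * Poly_Mapping.single m 1 = Poly_Mapping.single m c" for c :: 'k
    by (simp add: mconst_def mult_single)
  have "cls ` {f. Poly_Mapping.keys f \<subseteq> insert m M} = Q.line_extension (quot_scalars I) ?v ?E"
  proof safe
    fix f :: "('n, 'k) mpol" assume f: "Poly_Mapping.keys f \<subseteq> insert m M"
    define g where "g = f - Poly_Mapping.single m (Poly_Mapping.lookup f m)"
    have "Poly_Mapping.keys g \<subseteq> M"
      using f by (auto simp: g_def in_keys_iff lookup_minus lookup_single when_def split: if_splits)
    moreover have "cls f = cls (mconst (Poly_Mapping.lookup f m)) \<otimes>\<^bsub>Q\<^esub> ?v \<oplus>\<^bsub>Q\<^esub> cls g"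
      by (simp add: cls_mult cls_add mono g_def)
    ultimately show "cls f \<in> Q.line_extension (quot_scalars I) ?v ?E"
      by (auto simp: Q.line_extension_mem_iff quot_scalars_eq)
  next
    fix x assume "x \<in> Q.line_extension (quot_scalars I) ?v ?E"
    then obtain c g where g: "Poly_Mapping.keys g \<subseteq> M"
      and x: "x = cls (mconst c) \<otimes>\<^bsub>Q\<^esub> ?v \<oplus>\<^bsub>Q\<^esub> cls g"
      by (auto simp: Q.line_extension_mem_iff quot_scalars_eq)
    have "Poly_Mapping.keys (Poly_Mapping.single m c + g) \<subseteq> insert m M"
      using keys_add[of "Poly_Mapping.single m c" g] g by (auto split: if_splits)
    then show "x \<in> cls ` {f. Poly_Mapping.keys f \<subseteq> insert m M}"
      by (auto simp: x cls_mult cls_add mono)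
  qed
  moreover obtain n where "Q.dimension n (quot_scalars I) ?E"
    using insert.IH by (auto simp: Q.finite_dimension_def)
  ultimately show ?case
    using Q.dimension_line_extension[OF subfield_quot_scalars _ cls_in_carrier] Q.finite_dimensionI
    by metis
qed

lemma finite_dimension_quot_part: "Q.finite_dimension (quot_scalars I) (quot_part I d)"
proof -
  have "homogeneous_part d = {f :: ('n, 'k) mpol. Poly_Mapping.keys f \<subseteq> {m. mdegree m = d}}"
    by (auto simp: homogeneous_part_def mdegree_def)
  then show ?thesis using finite_dimension_cls_keys[OF finite_mdegree] by (simp add: quot_part_eq)
qed

text \<open>Moves the rank condition from cosets to representatives: from here on only membership of
  polynomials in \<open>I\<close> has to be checked.\<close>

lemma mult_power_max_rankI:
  assumes l: "l \<in> homogeneous_part 1"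
    and "(\<forall>f\<in>homogeneous_part i. l ^ j * f \<in> I \<longrightarrow> f \<in> I) \<or>
      (\<forall>g\<in>homogeneous_part (i + j). \<exists>f\<in>homogeneous_part i. g - l ^ j * f \<in> I)"
  shows "mult_power_max_rank I l j i"
proof -
  have hom: "l ^ j * f \<in> homogeneous_part (i + j)" if "f \<in> homogeneous_part i" for f
    using homogeneous_part_mult[OF homogeneous_part_power[OF l, of j] that] by (simp add: add.commute)
  have image: "(\<otimes>\<^bsub>Q\<^esub>) (cls (l ^ j)) ` quot_part I i = (\<lambda>f. cls (l ^ j * f)) ` homogeneous_part i"
    by (simp add: quot_part_eq image_image cls_mult)
  have "inj_on ((\<otimes>\<^bsub>Q\<^esub>) (cls (l ^ j))) (quot_part I i) \<or>
      (\<otimes>\<^bsub>Q\<^esub>) (cls (l ^ j)) ` quot_part I i = quot_part I (i + j)"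
    using assms(2)
  proof
    assume inj: "\<forall>f\<in>homogeneous_part i. l ^ j * f \<in> I \<longrightarrow> f \<in> I"
    have "f - g \<in> I" if "f \<in> homogeneous_part i" "g \<in> homogeneous_part i" "l ^ j * f - l ^ j * g \<in> I" for f g
    proof -
      have "f - g \<in> homogeneous_part i"
        using that(1,2) by (auto simp: homogeneous_part_iff lookup_minus) (metis diff_zero)
      with inj that(3) show ?thesis by (simp add: right_diff_distrib)
    qed
    then show ?thesis by (auto simp: inj_on_def quot_part_eq cls_mult cls_eq_iff)
  next
    assume surj: "\<forall>g\<in>homogeneous_part (i + j). \<exists>f\<in>homogeneous_part i. g - l ^ j * f \<in> I"
    have "quot_part I (i + j) \<subseteq> (\<lambda>f. cls (l ^ j * f)) ` homogeneous_part i"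
      using surj by (auto simp: quot_part_eq image_iff cls_eq_iff)
    then show ?thesis unfolding image using hom by (auto simp: quot_part_eq)
  qed
  then show ?thesis
    unfolding mult_power_max_rank_def quot_dim_def mult_power_map_cls
    by (intro Q.dim_mult_image_eq_min subfield_quot_scalars cls_in_carrier finite_dimension_quot_part)
      (auto simp: quot_part_eq cls_mult hom)
qed

end

section \<open>Strong Lefschetz property for cubic forms\<close>

lemma ideal_ann: "ideal (ann F) (mpol_ring :: ('n::finite, 'k::field_char_0) mpol ring)"
proof (rule idealI)
  interpret cring "mpol_ring :: ('n, 'k) mpol ring" by (rule cring_mpol_ring)
  show "ring (mpol_ring :: ('n, 'k) mpol ring)" by (rule ring_axioms)
  have minus: "\<ominus>\<^bsub>mpol_ring\<^esub> x = - x" for x :: "('n, 'k) mpol"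
    by (rule minus_equality) auto
  have zero: "0 \<in> ann F" by (simp add: ann_iff_dual_functional dual_functional_def)
  show "subgroup (ann F) (add_monoid mpol_ring)"
  proof (rule add.subgroupI)
    fix f g assume "f \<in> ann F" "g \<in> ann F"
    then show "f \<oplus>\<^bsub>mpol_ring\<^esub> g \<in> ann F"
      by (simp add: ann_iff_dual_functional distrib_left dual_functional_add)
    have "dual_functional F (h * - f) = 0" for h
      using \<open>f \<in> ann F\<close> by (metis ann_iff_dual_functional minus_mult_commute)
    then show "\<ominus>\<^bsub>mpol_ring\<^esub> f \<in> ann F"
      by (simp add: minus ann_iff_dual_functional)
  qed (use zero in auto)
  fix f g assume "f \<in> ann F"
  then have "dual_functional F (h * (g * f)) = 0" for h
    unfolding ann_iff_dual_functional by (metis mult.assoc)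
  then show "g \<otimes>\<^bsub>mpol_ring\<^esub> f \<in> ann F" "f \<otimes>\<^bsub>mpol_ring\<^esub> g \<in> ann F"
    by (simp_all add: ann_iff_dual_functional mult.commute)
qed

text \<open>
  Maps out of degree \<open>0\<close> and maps into degree \<open>3\<close> are settled by \<open>cube\<close>; the one remaining map,
  from degree \<open>1\<close> to degree \<open>2\<close>, is given by the Hessian matrix of \<open>F\<close> at \<open>c\<close>.
\<close>

lemma cubic_mult_power_max_rank:
  fixes F :: "('n::finite, 'k::field_char_0) mpol"
  assumes F: "F \<in> homogeneous_part 3"
    and cube: "dual_functional F (linear_form c ^ 3) \<noteq> 0"
    and ker: "\<And>v. (\<And>i. dual_functional F (mvar i * (linear_form c * linear_form v)) = 0) \<Longrightarrow>
      (\<And>i j. dual_functional F (mvar i * (mvar j * linear_form v)) = 0)"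
  shows "mult_power_max_rank (ann F) (linear_form c) j i"
proof -
  let ?l = "linear_form c" and ?D = "dual_functional F"
  have l: "?l \<in> homogeneous_part 1" by (rule homogeneous_part_linear_form)
  interpret mpol_quotient "ann F"
  proof (rule mpol_quotient.intro)
    show "1 \<notin> ann F"
      using cube by (metis ann_iff_dual_functional mult.right_neutral)
  qed (rule ideal_ann)
  \<comment> \<open>Everything of degree above 3 lies in \<open>ann F\<close>. Among the pairs with
    \<open>i + j \<le> 2\<close> and both entries positive only \<open>(1, 1)\<close>
    remains.\<close>
  consider (surj) "j = 0" | (zero) "i + j > 3" | (top) "i + j = 3"
    | (bot) "i = 0" "j \<le> 3" | (mid) "i = 1" "j = 1"
    by linarith
  then show ?thesis
  proof cases
    case surj
    have "g - ?l ^ j * g \<in> ann F" for g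
      by (simp add: surj ann_iff_dual_functional dual_functional_def)
    then show ?thesis using l surj by (intro mult_power_max_rankI) auto
  next
    case zero
    have "g \<in> ann F" if "g \<in> homogeneous_part (i + j)" for g
      using F that by (rule ann_homogeneousI) (use zero in simp)
    then have "g - ?l ^ j * 0 \<in> ann F" if "g \<in> homogeneous_part (i + j)" for g
      using that by simp
    then show ?thesis
      using l homogeneous_part_0 by (intro mult_power_max_rankI) blast+
  next
    case top
    have "\<exists>f\<in>homogeneous_part i. g - ?l ^ j * f \<in> ann F" if g: "g \<in> homogeneous_part (i + j)" for g
    proof
      \<comment> \<open>In degree 3 the functional alone decides membership in \<open>ann F\<close>,
        so the quotient is a line there, spanned by the class of \<open>?l ^ 3\<close>. The scalar
        \<open>?t\<close> is the coordinate of \<open>g\<close> on it.\<close>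
      let ?t = "?D g / ?D (?l ^ 3)"
      let ?f = "mconst ?t * ?l ^ i"
      show f: "?f \<in> homogeneous_part i"
        using homogeneous_part_mconst_mult[OF homogeneous_part_power[OF l, of i]] by simp
      have eq: "?l ^ j * ?f = mconst ?t * ?l ^ 3"
        by (simp add: power_add mult_ac flip: top)
      have "?l ^ 3 \<in> homogeneous_part 3"
        using homogeneous_part_power[OF l, of 3] by simp
      then have "g + mconst (- ?t) * ?l ^ 3 \<in> homogeneous_part 3"
        using g top by (intro homogeneous_part_add homogeneous_part_mconst_mult) auto
      moreover have "g + mconst (- ?t) * ?l ^ 3 = g - ?l ^ j * ?f"
        unfolding eq by (simp add: mconst_def single_uminus)
      ultimately have hom: "g - ?l ^ j * ?f \<in> homogeneous_part 3" by simp
      show "g - ?l ^ j * ?f \<in> ann F"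
        using F hom
      proof (rule ann_homogeneousI)
        fix m :: "'n \<Rightarrow>\<^sub>0 nat" assume "mdegree m + 3 = 3"
        then have "m = 0" by simp
        then show "?D (Poly_Mapping.single m 1 * (g - ?l ^ j * ?f)) = 0"
          using cube unfolding eq by (simp add: dual_functional_diff dual_functional_mconst)
      qed
    qed
    then show ?thesis using l by (intro mult_power_max_rankI) auto
  next
    case bot
    have "f \<in> ann F" if f: "f \<in> homogeneous_part i" "?l ^ j * f \<in> ann F" for f
    proof -
      have "f = mconst (Poly_Mapping.lookup f 0)"
        using f(1) bot by (intro poly_mapping_eqI)
          (auto simp: mconst_def lookup_single when_def homogeneous_part_iff)
      then obtain a where a: "f = mconst a" by blast
      \<comment> \<open>Multiplying up to degree 3 reduces every exponent \<open>j\<close> to the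
        nonvanishing of the functional on \<open>?l ^ 3\<close>.\<close>
      have "?D (?l ^ (3 - j) * (?l ^ j * f)) = 0"
        using f(2) by (simp add: ann_iff_dual_functional)
      moreover have "?l ^ (3 - j) * (?l ^ j * f) = mconst a * ?l ^ 3"
        using bot by (simp add: a mult_ac flip: power_add)
      ultimately have "a = 0" using cube by (simp add: dual_functional_mconst)
      then show ?thesis
        by (simp add: a ann_iff_dual_functional dual_functional_def mconst_0)
    qed
    then show ?thesis using l by (intro mult_power_max_rankI) auto
  next
    case mid
    have "f \<in> ann F" if f: "f \<in> homogeneous_part 1" "?l * f \<in> ann F" for f
      using F f(1)
    proof (rule ann_homogeneousI)
      obtain v where v: "f = linear_form v" using f(1) by (rule homogeneous_part_1_linear_form)
      have D: "?D (mvar i * (mvar j * f)) = 0" for i j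
        unfolding v using f(2) by (intro ker) (simp add: ann_iff_dual_functional v)
      fix m :: "'n \<Rightarrow>\<^sub>0 nat" assume "mdegree m + 1 = 3"
      then obtain i m' where m': "m = Poly_Mapping.single i 1 + m'" "mdegree m' = Suc 0"
        by (auto intro: mdegree_Suc_split[of m 1])
      from m'(2) obtain j m'' where "m' = Poly_Mapping.single j 1 + m''" "mdegree m'' = 0"
        by (rule mdegree_Suc_split)
      with m' have "m = Poly_Mapping.single i 1 + Poly_Mapping.single j 1" by simp
      then have "Poly_Mapping.single m 1 * f = mvar i * (mvar j * f)"
        by (simp add: mvar_def mult_single flip: mult.assoc)
      then show "?D (Poly_Mapping.single m 1 * f) = 0" using D by simp
    qed
    then show ?thesis using l mid by (intro mult_power_max_rankI) auto
  qed
qed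

text \<open>A principal open set suffices as the set of general linear forms, with \<open>c0\<close>
  as evidence that it is nonempty.\<close>

lemma strong_lefschetzI:
  assumes "meval c0 G \<noteq> 0"
    and "\<And>c i j. meval c G \<noteq> 0 \<Longrightarrow> mult_power_max_rank I (linear_form c) j i"
  shows "strong_lefschetz I"
  unfolding strong_lefschetz_def
proof (intro exI conjI)
  show "zariski_open {c. meval c G \<noteq> 0}"
    unfolding zariski_open_def by (rule exI[of _ "{G}"]) simp
qed (use assms in auto)

section \<open>Symmetric cubic forms\<close>

text \<open>Constant terms become values at the origin, so third derivatives can be simplified with
  the homomorphism rules for \<open>meval\<close>.\<close>

lemma lookup_0_eq_meval:
  fixes G :: "('n::finite, 'k::comm_semiring_1) mpol"
  shows "Poly_Mapping.lookup G 0 = meval (\<lambda>_. 0) G"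
proof (induction G rule: mpol_induct)
  case (single m c)
  have "(\<Prod>i\<in>UNIV. 0 ^ Poly_Mapping.lookup m i) = (if m = 0 then 1 else 0 :: 'k)"
  proof (cases "m = 0")
    case False
    then obtain i where "Poly_Mapping.lookup m i \<noteq> 0" by (metis poly_mapping_eqI lookup_zero)
    then have "\<exists>i\<in>UNIV. (0::'k) ^ Poly_Mapping.lookup m i = 0" by (metis UNIV_I power_eq_0_iff zero_power neq0_conv)
    then have "(\<Prod>i\<in>UNIV. (0::'k) ^ Poly_Mapping.lookup m i) = 0" by (intro prod_zero) auto
    then show ?thesis using False by simp
  qed simp
  then show ?case by (simp add: meval_eq_pairing lookup_single when_def)
qed (simp add: lookup_add meval_add)

definition symmetric_cubic :: "'k \<Rightarrow> 'k \<Rightarrow> 'k \<Rightarrow> ('n::finite, 'k::field_char_0) mpol" where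
  "symmetric_cubic a0 a1 a2 = mconst a0 * power_sum 1 ^ 3
     + mconst a1 * of_nat CARD('n) * power_sum 1 * power_sum 2
     + mconst a2 * of_nat CARD('n) ^ 2 * power_sum 3"

lemma mderiv_numeral [simp]: "mderiv i (numeral k) = 0"
  by (metis mderiv_mconst mconst_def single_numeral)

lemma mderiv_of_nat [simp]: "mderiv i (of_nat k) = 0"
  by (metis mderiv_mconst mconst_def single_of_nat)

lemma mderiv_power_sum:
  fixes i :: "'a::finite"
  shows "mderiv i (power_sum 1 :: ('a, 'b::comm_semiring_1) mpol) = 1" "mderiv i (power_sum 2 :: ('a, 'b) mpol) = 2 * mvar i"
  "mderiv i (power_sum 3 :: ('a, 'b) mpol) = 3 * (mvar i * mvar i)"
proof -
  have 2: "f + f = 2 * f" and 3: "f + (f + f) = 3 * f" for f :: "('a, 'b) mpol"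
    using distrib_right[of 1 1 f] distrib_right[of 1 2 f] by simp_all
  show "mderiv i (power_sum 1 :: ('a, 'b) mpol) = 1"
    "mderiv i (power_sum 2 :: ('a, 'b) mpol) = 2 * mvar i"
    "mderiv i (power_sum 3 :: ('a, 'b) mpol) = 3 * (mvar i * mvar i)"
    by (simp_all add: power_sum_def mderiv_sum mderiv_mult mderiv_mvar power2_eq_square
        power3_eq_cube if_distrib if_distribR sum.distrib distrib_right add.assoc cong: if_cong flip: 2 3)
qed

lemma dual_symmetric_cubic:
  fixes a0 a1 a2 :: "'k::field_char_0" and i j k :: "'n::finite"
  shows "dual_functional (symmetric_cubic a0 a1 a2) (mvar i * (mvar j * mvar k)) =
    6 * a0 + 2 * a1 * of_nat CARD('n) * (of_bool (i = j) + of_bool (j = k) + of_bool (i = k))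
      + 6 * a2 * of_nat CARD('n) ^ 2 * of_bool (i = j \<and> j = k)"
  unfolding dual_functional_mvar_cube lookup_0_eq_meval symmetric_cubic_def
  by (simp add: mderiv_add mderiv_mult mderiv_power_sum mderiv_mvar power2_eq_square
      power3_eq_cube meval_add meval_mult meval_power_sum algebra_simps
      del: One_nat_def)

lemma homogeneous_symmetric_cubic:
  "(symmetric_cubic a0 a1 a2 :: ('n::finite, 'k::field_char_0) mpol) \<in> homogeneous_part 3"
proof -
  let ?p = "power_sum :: nat \<Rightarrow> ('n, 'k) mpol"
  have of_nat: "of_nat k = (mconst (of_nat k) :: ('n, 'k) mpol)" for k
    by (simp add: mconst_def)
  have "?p 1 ^ 3 \<in> homogeneous_part (3 * 1)" "?p 1 * ?p 2 \<in> homogeneous_part (1 + 2)"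
    by (intro homogeneous_part_power homogeneous_part_mult homogeneous_part_power_sum)+
  then have "?p 1 ^ 3 \<in> homogeneous_part 3" "?p 1 * ?p 2 \<in> homogeneous_part 3"
    by (simp_all del: One_nat_def)
  then show ?thesis
    unfolding symmetric_cubic_def power2_eq_square of_nat mconst_mult mult.assoc
    unfolding mult.assoc[symmetric] mconst_mult
    by (simp add: mult.assoc homogeneous_part_add homogeneous_part_mconst_mult
        homogeneous_part_power_sum del: One_nat_def)
qed

lemma meval_symmetric_cubic:
  fixes c :: "'n::finite \<Rightarrow> 'k::field_char_0"
  shows "meval c (symmetric_cubic a0 a1 a2) = a0 * (\<Sum>i\<in>UNIV. c i) ^ 3
     + a1 * of_nat CARD('n) * (\<Sum>i\<in>UNIV. c i) * (\<Sum>i\<in>UNIV. c i ^ 2)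
     + a2 * of_nat CARD('n) ^ 2 * (\<Sum>i\<in>UNIV. c i ^ 3)"
  by (simp add: symmetric_cubic_def meval_add meval_mult meval_power meval_power_sum)

text \<open>Component \<open>i\<close> of the Hessian matrix of the symmetric cubic at
  \<open>c\<close> applied to \<open>v\<close>. It is bilinear and symmetric in \<open>c\<close> and
  \<open>v\<close>, being the polarised cubic with one slot left open.\<close>

definition hessian_apply ::
    "'k \<Rightarrow> 'k \<Rightarrow> 'k \<Rightarrow> ('n::finite \<Rightarrow> 'k::field_char_0) \<Rightarrow> ('n \<Rightarrow> 'k) \<Rightarrow> 'n \<Rightarrow> 'k" where
  "hessian_apply a0 a1 a2 c v i = 6 * a0 * sum c UNIV * sum v UNIV
     + 2 * a1 * of_nat CARD('n) * (c i * sum v UNIV + (\<Sum>j\<in>UNIV. c j * v j) + sum c UNIV * v i)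
     + 6 * a2 * of_nat CARD('n) ^ 2 * (c i * v i)"

lemma dual_symmetric_cubic_hessian:
  fixes c v :: "'n::finite \<Rightarrow> 'k::field_char_0"
  shows "dual_functional (symmetric_cubic a0 a1 a2) (mvar i * (linear_form c * linear_form v)) =
    hessian_apply a0 a1 a2 c v i"
proof -
  let ?n = "of_nat CARD('n) :: 'k"
  have if_sum: "(\<Sum>k\<in>UNIV. if P then g k else 0) = (if P then sum g UNIV else 0)"
    for P and g :: "'n \<Rightarrow> 'k"
    by simp
  have "mvar i * (linear_form c * linear_form v) =
      (\<Sum>j\<in>UNIV. \<Sum>k\<in>UNIV. mconst (c j * v k) * (mvar i * (mvar j * mvar k)))"
    unfolding linear_form_def sum_product unfolding sum_distrib_left
    by (intro sum.cong refl) (simp add: mult_ac flip: mconst_mult)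
  then have "dual_functional (symmetric_cubic a0 a1 a2) (mvar i * (linear_form c * linear_form v)) =
     (\<Sum>j\<in>UNIV. \<Sum>k\<in>UNIV. c j * v k * (6 * a0
        + 2 * a1 * ?n * (of_bool (i = j) + of_bool (j = k) + of_bool (i = k))
        + 6 * a2 * ?n ^ 2 * of_bool (i = j \<and> j = k)))"
    by (simp add: dual_functional_sum dual_functional_mconst dual_symmetric_cubic)
  also have "\<dots> = (\<Sum>j\<in>UNIV. \<Sum>k\<in>UNIV. 6 * a0 * (c j * v k))
     + (\<Sum>j\<in>UNIV. \<Sum>k\<in>UNIV. if i = j then 2 * a1 * ?n * (c j * v k) else 0)
     + (\<Sum>j\<in>UNIV. \<Sum>k\<in>UNIV. if j = k then 2 * a1 * ?n * (c j * v k) else 0)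
     + (\<Sum>j\<in>UNIV. \<Sum>k\<in>UNIV. if i = k then 2 * a1 * ?n * (c j * v k) else 0)
     + (\<Sum>j\<in>UNIV. \<Sum>k\<in>UNIV. if i = j then if j = k then 6 * a2 * ?n ^ 2 * (c j * v k) else 0 else 0)"
    unfolding sum.distrib[symmetric] by (intro sum.cong refl) (simp add: algebra_simps)
  also have "\<dots> = hessian_apply a0 a1 a2 c v i"
    by (simp add: if_sum hessian_apply_def distrib_left mult.assoc
        flip: sum_distrib_left sum_distrib_right)
  finally show ?thesis .
qed

lemma mvar_eq_linear_form: "mvar j = linear_form (\<lambda>k. of_bool (k = j))"
  by (simp add: linear_form_def of_bool_def if_distrib if_distribR mconst_0 mconst_1 cong: if_cong)

text \<open>Euler's identity applied twice: pairing the Hessian at \<open>c\<close> with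
  \<open>c\<close> in both slots gives \<open>3 * 2\<close> times the value of the cubic.\<close>

lemma dual_symmetric_cubic_cube:
  fixes c :: "'n::finite \<Rightarrow> 'k::field_char_0"
  shows "dual_functional (symmetric_cubic a0 a1 a2) (linear_form c ^ 3) =
    6 * meval c (symmetric_cubic a0 a1 a2)"
proof -
  have "linear_form c ^ 3 = (\<Sum>i\<in>UNIV. mconst (c i) * (mvar i * (linear_form c * linear_form c)))"
    by (simp add: power3_eq_cube linear_form_def sum_distrib_right mult_ac)
  then have "dual_functional (symmetric_cubic a0 a1 a2) (linear_form c ^ 3) =
    (\<Sum>i\<in>UNIV. c i * hessian_apply a0 a1 a2 c c i)"
    by (simp add: dual_functional_sum dual_functional_mconst dual_symmetric_cubic_hessian)
  also have "\<dots> = (\<Sum>i\<in>UNIV. 6 * a0 * sum c UNIV ^ 2 * c i 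
      + 2 * a1 * of_nat CARD('n) * (2 * sum c UNIV * c i ^ 2 + (\<Sum>j\<in>UNIV. c j ^ 2) * c i)
      + 6 * a2 * of_nat CARD('n) ^ 2 * c i ^ 3)"
    by (intro sum.cong) (simp_all add: hessian_apply_def power2_eq_square power3_eq_cube algebra_simps)
  also have "\<dots> = 6 * a0 * sum c UNIV ^ 2 * sum c UNIV
      + 2 * a1 * of_nat CARD('n) * (2 * sum c UNIV * (\<Sum>i\<in>UNIV. c i ^ 2) + (\<Sum>j\<in>UNIV. c j ^ 2) * sum c UNIV)
      + 6 * a2 * of_nat CARD('n) ^ 2 * (\<Sum>i\<in>UNIV. c i ^ 3)"
    by (simp only: sum.distrib sum_distrib_left[symmetric])
  also have "\<dots> = 6 * meval c (symmetric_cubic a0 a1 a2)"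
    unfolding meval_symmetric_cubic by (simp add: algebra_simps power2_eq_square power3_eq_cube)
  finally show ?thesis .
qed

text \<open>
  The parameter \<open>b\<close> adds a multiple of the all-ones matrix to the Hessian matrix; it repairs the
  one family of cubics whose Hessian is degenerate at every point without being of rank one.
\<close>

lemma strong_lefschetz_symmetric_cubicI:
  fixes c0 :: "'n::finite \<Rightarrow> 'k::field_char_0"
  assumes c0: "meval c0 (symmetric_cubic a0 a1 a2) \<noteq> 0"
    and nondeg: "\<And>v. (\<And>i. hessian_apply a0 a1 a2 c0 v i + b * sum v UNIV = 0) \<Longrightarrow> (\<And>i. v i = 0)"
    and ker: "\<And>(c :: 'n \<Rightarrow> 'k) v. \<lbrakk>\<And>u. (\<And>i. hessian_apply a0 a1 a2 c u i + b * sum u UNIV = 0) \<Longrightarrow> (\<And>i. u i = 0);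
        \<And>i. hessian_apply a0 a1 a2 c v i = 0\<rbrakk> \<Longrightarrow> (\<And>d i. hessian_apply a0 a1 a2 d v i = 0)"
  shows "strong_lefschetz (ann (symmetric_cubic a0 a1 a2 :: ('n, 'k) mpol))"
proof -
  let ?F = "symmetric_cubic a0 a1 a2 :: ('n, 'k) mpol" and ?n = "of_nat CARD('n) :: 'k"
  \<comment> \<open>The Hessian matrix of \<open>?F\<close> with polynomial entries, plus
    \<open>b\<close> times the all-ones matrix. Multiplying its determinant by \<open>?F\<close>
    imposes both open conditions with a single polynomial.\<close>
  let ?A = "(\<chi> i j. mconst (6 * a0) * power_sum 1 + mconst (2 * a1 * ?n) * (mvar i + mvar j)
     + (if i = j then mconst (2 * a1 * ?n) * power_sum 1 + mconst (6 * a2 * ?n ^ 2) * mvar i else 0)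
     + mconst b) :: ('n, 'k) mpol ^ 'n ^ 'n"
  let ?B = "\<lambda>c. (\<chi> i j. meval c (?A $ i $ j)) :: 'k ^ 'n ^ 'n"
  have mult: "(?B c *v x) $ i = hessian_apply a0 a1 a2 c (($) x) i + b * sum (($) x) UNIV" for c x i
  proof -
    have "(?B c *v x) $ i = (\<Sum>j\<in>UNIV. 6 * a0 * sum c UNIV * x $ j
        + 2 * a1 * ?n * (c i * x $ j + c j * x $ j) + b * x $ j
        + (if i = j then (2 * a1 * ?n * sum c UNIV + 6 * a2 * ?n ^ 2 * c i) * x $ j else 0))"
      unfolding matrix_vector_mult_def
      by (auto simp: meval_add meval_mult meval_power_sum algebra_simps intro!: sum.cong)
    also have "\<dots> = hessian_apply a0 a1 a2 c (($) x) i + b * sum (($) x) UNIV"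
      by (simp add: sum.distrib hessian_apply_def distrib_left distrib_right mult.assoc
          flip: sum_distrib_left)
    finally show ?thesis .
  qed
  have det: "det (?B c) \<noteq> 0 \<longleftrightarrow> (\<forall>v. (\<forall>i. hessian_apply a0 a1 a2 c v i + b * sum v UNIV = 0) \<longrightarrow> (\<forall>i. v i = 0))" for c
  proof -
    have "det (?B c) \<noteq> 0 \<longleftrightarrow> (\<forall>x. ?B c *v x = 0 \<longrightarrow> x = 0)"
      using invertible_det_nz[of "?B c"] invertible_left_inverse[of "?B c"]
        matrix_left_invertible_ker[of "?B c"] by blast
    also have "\<dots> \<longleftrightarrow> (\<forall>x. (\<forall>i. hessian_apply a0 a1 a2 c (($) x) i + b * sum (($) x) UNIV = 0) \<longrightarrow> (\<forall>i. x $ i = 0))"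
      by (simp only: vec_eq_iff mult zero_index)
    also have "\<dots> \<longleftrightarrow> (\<forall>v. (\<forall>i. hessian_apply a0 a1 a2 c v i + b * sum v UNIV = 0) \<longrightarrow> (\<forall>i. v i = 0))"
    proof (intro iffI allI)
      fix v i
      assume "\<forall>x::'k^'n. (\<forall>i. hessian_apply a0 a1 a2 c (($) x) i + b * sum (($) x) UNIV = 0) \<longrightarrow> (\<forall>i. x $ i = 0)"
      from spec[OF this, of "\<chi> i. v i"]
      show "(\<forall>i. hessian_apply a0 a1 a2 c v i + b * sum v UNIV = 0) \<longrightarrow> (\<forall>i. v i = 0)" 
        by (simp add: vec_lambda_inverse)
    qed blast
    finally show ?thesis .
  qed
  show ?thesis
  proof (rule strong_lefschetzI)
    have "det (?B c0) \<noteq> 0" using det nondeg by blast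
    then show "meval c0 (?F * det ?A) \<noteq> 0"
      using c0 by (simp only: meval_mult meval_det mult_eq_0_iff simp_thms)
  next
    fix c i j assume "meval c (?F * det ?A) \<noteq> 0"
    then have c: "meval c ?F \<noteq> 0" "det (?B c) \<noteq> 0"
      by (simp_all only: meval_mult meval_det mult_eq_0_iff de_Morgan_disj not_False_eq_True)
    show "mult_power_max_rank (ann ?F) (linear_form c) j i"
    proof (rule cubic_mult_power_max_rank[OF homogeneous_symmetric_cubic])
      show "dual_functional ?F (linear_form c ^ 3) \<noteq> 0"
        using c(1) by (simp add: dual_symmetric_cubic_cube)
      fix v i j
      assume v: "\<And>i. dual_functional ?F (mvar i * (linear_form c * linear_form v)) = 0"
      \<comment> \<open>The variable \<open>mvar j\<close> is the linear form of a unit vector, so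
        the claim concerns the Hessian at that unit vector.\<close>
      have "hessian_apply a0 a1 a2 (\<lambda>k. of_bool (k = j)) v i = 0"
      proof (rule ker)
        show "u i = 0" if "\<And>i. hessian_apply a0 a1 a2 c u i + b * sum u UNIV = 0" for u i
          using c(2) that unfolding det by blast
        show "hessian_apply a0 a1 a2 c v i = 0" for i
          using v[of i] by (simp add: dual_symmetric_cubic_hessian)
      qed
      then show "dual_functional ?F (mvar i * (mvar j * linear_form v)) = 0"
        by (simp add: mvar_eq_linear_form[of j] dual_symmetric_cubic_hessian)
    qed
  qed
qed

section \<open>Test points and the individual families of cubics\<close>

lemma sum_two_valued:
  fixes k :: "'n::finite" and a b :: "'k::comm_ring_1"
  shows "(\<Sum>i\<in>UNIV. if i = k then a else b) = a + (of_nat CARD('n) - 1) * b"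
proof -
  have "(\<Sum>i\<in>UNIV. if i = k then a else b) = (\<Sum>i\<in>UNIV. (if i = k then a - b else 0) + b)"
    by (intro sum.cong) auto
  also have "\<dots> = (a - b) + of_nat CARD('n) * b" by (simp add: sum.distrib)
  finally show ?thesis by (simp add: algebra_simps)
qed

lemma of_nat_card_neq:
  assumes "CARD('n::finite) \<ge> 3"
  shows "of_nat CARD('n) \<notin> {0, 1, 2 :: 'k::field_char_0}"
  using assms of_nat_eq_iff[of "CARD('n)" 1, where ?'a='k]
    of_nat_eq_iff[of "CARD('n)" 2, where ?'a='k] by auto

text \<open>Some translate of this point has a generic Hessian whenever \<open>a2 \<noteq> 0\<close>.\<close>

definition balanced :: "'n::finite \<Rightarrow> 'n \<Rightarrow> 'k::field_char_0" where
  "balanced k i = (if i = k then 1 - of_nat CARD('n) else 1)"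

text \<open>At a point with coordinate sum 0 only the \<open>p_3\<close> term of the cubic survives;
  the factor \<open>n - 2\<close> keeps it from vanishing when \<open>n \<ge> 3\<close>.\<close>

lemma sum_balanced:
  fixes k :: "'n::finite"
  shows "(\<Sum>i\<in>UNIV. balanced k i) = (0 :: 'k::field_char_0)"
    and "(\<Sum>i\<in>UNIV. balanced k i ^ 3) =
      - (of_nat CARD('n) * (of_nat CARD('n) - 1) * (of_nat CARD('n) - 2) :: 'k::field_char_0)"
proof -
  show "(\<Sum>i\<in>UNIV. balanced k i) = (0 :: 'k)"
    unfolding balanced_def sum_two_valued by (simp add: algebra_simps)
  have "(\<Sum>i\<in>UNIV. balanced k i ^ 3) =
      (\<Sum>i\<in>UNIV. if i = k then (1 - of_nat CARD('n)) ^ 3 else 1 :: 'k)"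
    by (intro sum.cong) (auto simp: balanced_def)
  then show "(\<Sum>i\<in>UNIV. balanced k i ^ 3) =
      - (of_nat CARD('n) * (of_nat CARD('n) - 1) * (of_nat CARD('n) - 2) :: 'k)"
    unfolding sum_two_valued by (simp add: algebra_simps power3_eq_cube)
qed

text \<open>The equations force \<open>v i\<close> to be \<open>q / (n y_i)\<close> with
  \<open>y = balanced k\<close>. The reciprocals of the \<open>y_i\<close> sum to
  \<open>n (n - 2) / (n - 1)\<close>, which is not 0, so sum zero of \<open>v\<close> forces
  \<open>q = 0\<close>.\<close>

lemma balanced_eq_0:
  fixes v :: "'n::finite \<Rightarrow> 'k::field_char_0"
  assumes n: "CARD('n) \<ge> 3" and s: "sum v UNIV = 0"
    and v: "\<And>i. of_nat CARD('n) * (balanced k i * v i) = q"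
  shows "v i = 0"
proof -
  let ?n = "of_nat CARD('n) :: 'k"
  have nz: "?n \<noteq> 0" "?n \<noteq> 1" "?n \<noteq> 2"
    using of_nat_card_neq[OF n] by auto
  have "?n * (?n - 1) * v i = (if i = k then - q else (?n - 1) * q)" for i
    using v[of i] by (auto simp: balanced_def algebra_simps)
  then have "?n * (?n - 1) * sum v UNIV = (\<Sum>i\<in>UNIV. if i = k then - q else (?n - 1) * q)"
    unfolding sum_distrib_left by (intro sum.cong) auto
  then have "?n * (?n - 2) * q = 0"
    unfolding s sum_two_valued by (simp add: algebra_simps)
  then have "q = 0" using nz by simp
  then show ?thesis using v[of i] nz by (auto simp: balanced_def split: if_splits)
qed

text \<open>For the third central moment every Hessian kills the constant vectors.\<close>

lemma strong_lefschetz_central_moment: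
  fixes a :: "'k::field_char_0"
  assumes n: "CARD('n::finite) \<ge> 3" and a: "a \<noteq> 0"
  shows "strong_lefschetz (ann (symmetric_cubic (2 * a) (- 3 * a) a :: ('n, 'k) mpol))"
proof (rule strong_lefschetz_symmetric_cubicI)
  let ?n = "of_nat CARD('n) :: 'k"
  \<comment> \<open>Here \<open>undefined\<close> is just an arbitrary fixed index.\<close>
  let ?y = "balanced undefined :: 'n \<Rightarrow> 'k"
  have nz: "?n \<noteq> 0" "?n \<noteq> 1" "?n \<noteq> 2"
    using of_nat_card_neq[OF n] by auto
  show "meval ?y (symmetric_cubic (2 * a) (- 3 * a) a) \<noteq> 0"
    unfolding meval_symmetric_cubic sum_balanced using nz a by simp
  show "v i = 0" if h: "\<And>i. hessian_apply (2 * a) (- 3 * a) a ?y v i + 1 * sum v UNIV = 0" for v i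
  proof -
    let ?q = "\<Sum>j\<in>UNIV. ?y j * v j"
    have h: "(sum v UNIV - 6 * a * ?n * ?q) + (- 6 * a * ?n * sum v UNIV) * ?y i
        + 6 * a * ?n ^ 2 * (?y i * v i) = 0" for i
      using h[of i] unfolding hessian_apply_def sum_balanced by (simp add: algebra_simps)
    \<comment> \<open>Summation pairs the Hessian with the all-ones vector, which is in its kernel,
      so the Hessian terms cancel. Only the added all-ones matrix, taken with \<open>b = 1\<close>,
      contributes: it leaves \<open>n\<close> times the sum of \<open>v\<close>.\<close>
    have "(\<Sum>i\<in>UNIV. (sum v UNIV - 6 * a * ?n * ?q) + (- 6 * a * ?n * sum v UNIV) * ?y i
        + 6 * a * ?n ^ 2 * (?y i * v i)) = 0"
      using h by simp
    then have "?n * (sum v UNIV - 6 * a * ?n * ?q) + 6 * a * ?n ^ 2 * ?q = 0"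
      unfolding sum.distrib sum_distrib_left[symmetric] sum_balanced by simp
    then have s: "sum v UNIV = 0" using nz by (simp add: algebra_simps power2_eq_square)
    have "?n * (?y i * v i) = ?q" for i
    proof -
      have "6 * a * ?n * (?n * (?y i * v i) - ?q) = 0"
        using h[of i] unfolding s by (simp add: algebra_simps power2_eq_square)
      then show ?thesis using nz a by simp
    qed
    then show ?thesis using balanced_eq_0[OF n s] by blast
  qed
  show "hessian_apply (2 * a) (- 3 * a) a d v i = 0"
    if c: "\<And>(u :: 'n \<Rightarrow> 'k) i. (\<And>i. hessian_apply (2 * a) (- 3 * a) a c u i + 1 * sum u UNIV = 0) \<Longrightarrow> u i = 0"
      and v: "\<And>i. hessian_apply (2 * a) (- 3 * a) a c v i = 0" for c v d i
  proof -
    \<comment> \<open>Subtracting the mean does not change the Hessian image, since constants are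
      killed, and it makes the added \<open>b\<close> term vanish. Nondegeneracy of the modified
      matrix then shows that \<open>v\<close> is constant.\<close>
    define m where "m = sum v UNIV / ?n"
    have sum_v: "sum v UNIV = ?n * m" using nz by (simp add: m_def)
    have s: "(\<Sum>j\<in>UNIV. v j - m) = 0" by (simp add: sum_subtractf sum_v)
    have cv: "(\<Sum>j\<in>UNIV. c j * (v j - m)) = (\<Sum>j\<in>UNIV. c j * v j) - sum c UNIV * m" for c
      by (simp add: right_diff_distrib sum_subtractf sum_distrib_right)
    have "hessian_apply (2 * a) (- 3 * a) a c (\<lambda>j. v j - m) i =
        hessian_apply (2 * a) (- 3 * a) a c v i" for i
      unfolding hessian_apply_def s cv sum_v by (simp add: algebra_simps power2_eq_square)
    then have "hessian_apply (2 * a) (- 3 * a) a c (\<lambda>j. v j - m) i + 1 * (\<Sum>j\<in>UNIV. v j - m) = 0" for i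
      by (simp only: v s mult_zero_right add_0)
    then have "v i - m = 0" for i
      by (rule c[of "\<lambda>j. v j - m"])
    then have v_eq: "v j = m" for j by simp
    have "(\<Sum>j\<in>UNIV. d j * v j) = sum d UNIV * m" by (simp add: v_eq sum_distrib_right)
    then show ?thesis
      unfolding hessian_apply_def sum_v v_eq by (simp add: algebra_simps power2_eq_square)
  qed
qed

text \<open>The case \<open>b = 0\<close>: where the Hessian is nonsingular its kernel is zero, so
  the kernel condition is trivial.\<close>

lemma strong_lefschetz_nondegenerate:
  fixes c0 :: "'n::finite \<Rightarrow> 'k::field_char_0"
  assumes c0: "meval c0 (symmetric_cubic a0 a1 a2) \<noteq> 0"
    and nondeg: "\<And>v i. (\<And>i. hessian_apply a0 a1 a2 c0 v i = 0) \<Longrightarrow> v i = 0"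
  shows "strong_lefschetz (ann (symmetric_cubic a0 a1 a2 :: ('n, 'k) mpol))"
proof (rule strong_lefschetz_symmetric_cubicI[OF c0, where b = 0])
  show "v i = 0" if "\<And>i. hessian_apply a0 a1 a2 c0 v i + 0 * sum v UNIV = 0" for v i
    using that nondeg by simp
  show "hessian_apply a0 a1 a2 d v i = 0"
    if "\<And>u i. (\<And>i. hessian_apply a0 a1 a2 c u i + 0 * sum u UNIV = 0) \<Longrightarrow> u i = 0"
      and "\<And>i. hessian_apply a0 a1 a2 c v i = 0" for c v d i
  proof -
    have "v i = 0" for i using that by simp
    then show ?thesis by (simp add: hessian_apply_def)
  qed
qed

text \<open>The Hessian at \<open>c\<close> is the all-ones matrix scaled by
  \<open>6 * a * sum c UNIV\<close>. Wherever the cubic does not vanish, its kernel is the same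
  hyperplane of sum-zero vectors.\<close>

lemma strong_lefschetz_cube:
  fixes a :: "'k::field_char_0"
  assumes a: "a \<noteq> 0"
  shows "strong_lefschetz (ann (symmetric_cubic a 0 0 :: ('n::finite, 'k) mpol))"
proof (rule strong_lefschetzI)
  let ?F = "symmetric_cubic a 0 0 :: ('n, 'k) mpol"
  show "meval (\<lambda>_. 1) ?F \<noteq> 0"
    unfolding meval_symmetric_cubic using a by simp
  fix c i j assume c: "meval c ?F \<noteq> 0"
  then have s: "sum c UNIV \<noteq> 0" unfolding meval_symmetric_cubic by auto
  show "mult_power_max_rank (ann ?F) (linear_form c) j i"
  proof (rule cubic_mult_power_max_rank[OF homogeneous_symmetric_cubic])
    show "dual_functional ?F (linear_form c ^ 3) \<noteq> 0"
      using c by (simp add: dual_symmetric_cubic_cube)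
    fix v i j
    assume "\<And>i. dual_functional ?F (mvar i * (linear_form c * linear_form v)) = 0"
    then have "sum v UNIV = 0"
      using a s by (simp add: dual_symmetric_cubic_hessian hessian_apply_def)
    then show "dual_functional ?F (mvar i * (mvar j * linear_form v)) = 0"
      by (simp add: mvar_eq_linear_form[of j] dual_symmetric_cubic_hessian hessian_apply_def)
  qed
qed

lemma strong_lefschetz_symmetric_cubic:
  fixes a0 a1 a2 :: "'k::field_char_0"
  assumes n: "CARD('n::finite) \<ge> 3" and a: "a0 \<noteq> 0 \<or> a1 \<noteq> 0 \<or> a2 \<noteq> 0"
  shows "strong_lefschetz (ann (symmetric_cubic a0 a1 a2 :: ('n, 'k) mpol))"
proof -
  let ?n = "of_nat CARD('n) :: 'k"
  let ?y = "balanced undefined :: 'n \<Rightarrow> 'k"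
  have nz: "?n \<noteq> 0" "?n \<noteq> 1" "?n \<noteq> 2"
    using of_nat_card_neq[OF n] by auto
  \<comment> \<open>For \<open>a2 \<noteq> 0\<close> the sum-zero point works unless
    \<open>a1 + 3 * a2 = 0\<close>, that is, unless the cubic is a central moment plus a multiple of
    \<open>p_1^3\<close>. For \<open>a2 = 0\<close> the all-ones point works unless
    \<open>a0 + a1 = 0\<close>, where the cubic vanishes at it.\<close>
  consider (cube) "a1 = 0" "a2 = 0" "a0 \<noteq> 0"
    | (moment) "a2 \<noteq> 0" "a1 = - 3 * a2" "a0 = 2 * a2"
    | (shifted) "a2 \<noteq> 0" "a1 = - 3 * a2" "a0 \<noteq> 2 * a2"
    | (balanced) "a2 \<noteq> 0" "a1 + 3 * a2 \<noteq> 0"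
    | (ones) "a2 = 0" "a1 \<noteq> 0" "a0 + a1 \<noteq> 0"
    | (unit) "a2 = 0" "a1 \<noteq> 0" "a0 = - a1"
    using a eq_neg_iff_add_eq_0[of a1 "3 * a2"] eq_neg_iff_add_eq_0[of a0 a1] by (auto simp: mult_minus_left)
  then show ?thesis
  proof cases
    case cube
    then show ?thesis using strong_lefschetz_cube by simp
  next
    case moment
    then show ?thesis using strong_lefschetz_central_moment[OF n] by simp
  next
    case balanced
    show ?thesis
    proof (rule strong_lefschetz_nondegenerate[of ?y])
      show "meval ?y (symmetric_cubic a0 a1 a2) \<noteq> 0"
        unfolding meval_symmetric_cubic sum_balanced using nz balanced by simp
      fix v i
      assume h: "\<And>i. hessian_apply a0 a1 a2 ?y v i = 0"
      let ?q = "\<Sum>j\<in>UNIV. ?y j * v j" and ?s = "sum v UNIV"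
      have h: "a1 * ?q + a1 * ?s * ?y i + 3 * a2 * ?n * (?y i * v i) = 0" for i
      proof -
        have "2 * ?n * (a1 * ?q + a1 * ?s * ?y i + 3 * a2 * ?n * (?y i * v i)) = 0"
          using h[of i] unfolding hessian_apply_def sum_balanced
          by (simp add: algebra_simps power2_eq_square)
        then show ?thesis using nz by simp
      qed
      \<comment> \<open>Two summations, each producing the factor \<open>a1 + 3 * a2\<close>: the
        first removes \<open>?q\<close>; after cancelling \<open>?y i\<close> the second removes
        \<open>?s\<close>.\<close>
      have "(\<Sum>i\<in>UNIV. a1 * ?q + a1 * ?s * ?y i + 3 * a2 * ?n * (?y i * v i)) = 0"
        using h by simp
      then have "?n * (a1 + 3 * a2) * ?q = 0"
        unfolding sum.distrib sum_distrib_left[symmetric] sum_balanced by (simp add: algebra_simps)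
      then have q: "?q = 0" using nz balanced by simp
      have v: "a1 * ?s + 3 * a2 * ?n * v i = 0" for i
      proof -
        have "?y i * (a1 * ?s + 3 * a2 * ?n * v i) = 0"
          using h[of i] unfolding q by (simp add: algebra_simps)
        moreover have "?y i \<noteq> 0" using nz by (simp add: balanced_def)
        ultimately show ?thesis by simp
      qed
      have "(\<Sum>i\<in>UNIV. a1 * ?s + 3 * a2 * ?n * v i) = 0" using v by simp
      then have "?n * (a1 + 3 * a2) * ?s = 0"
        unfolding sum.distrib sum_distrib_left[symmetric] by (simp add: algebra_simps)
      then have "?s = 0" using nz balanced by simp
      then show "v i = 0" using v[of i] nz balanced by simp
    qed
  next
    case shifted
    let ?P3 = "- (?n * (?n - 1) * (?n - 2))"
    \<comment> \<open>The coefficient of \<open>p_1^3\<close> left after splitting off the central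
      moment part. A translation by \<open>m\<close> changes only that cube.\<close>
    define d where "d = a0 - 2 * a2"
    have a0: "a0 = d + 2 * a2" and d: "d \<noteq> 0" using shifted by (simp_all add: d_def)
    have meval: "meval (\<lambda>i. ?y i + m) (symmetric_cubic a0 a1 a2) =
        ?n ^ 3 * m ^ 3 * d + a2 * ?n ^ 2 * ?P3" for m
    proof -
      let ?P2 = "\<Sum>i\<in>UNIV. ?y i ^ 2"
      have 1: "(\<Sum>i\<in>UNIV. ?y i + m) = ?n * m" by (simp add: sum.distrib sum_balanced)
      have "(\<Sum>i\<in>UNIV. (?y i + m) ^ 2) = (\<Sum>i\<in>UNIV. ?y i ^ 2 + 2 * m * ?y i + m ^ 2)"
        by (intro sum.cong) (auto simp: power2_eq_square algebra_simps)
      then have 2: "(\<Sum>i\<in>UNIV. (?y i + m) ^ 2) = ?P2 + ?n * m ^ 2"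
        unfolding sum.distrib sum_distrib_left[symmetric] sum_balanced by simp
      have "(\<Sum>i\<in>UNIV. (?y i + m) ^ 3) =
          (\<Sum>i\<in>UNIV. ?y i ^ 3 + 3 * m * ?y i ^ 2 + 3 * m ^ 2 * ?y i + m ^ 3)"
        by (intro sum.cong) (auto simp: power2_eq_square power3_eq_cube algebra_simps)
      then have 3: "(\<Sum>i\<in>UNIV. (?y i + m) ^ 3) = ?P3 + 3 * m * ?P2 + ?n * m ^ 3"
        unfolding sum.distrib sum_distrib_left[symmetric] sum_balanced by simp
      show ?thesis
        unfolding meval_symmetric_cubic 1 2 3 a0 shifted(2)
        by (simp add: power2_eq_square power3_eq_cube algebra_simps)
    qed
    have "a2 * ?n ^ 2 * ?P3 \<noteq> 0" using nz shifted by simp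
    moreover have "meval (\<lambda>i. ?y i + 1) (symmetric_cubic a0 a1 a2)
        + meval (\<lambda>i. ?y i + (- 1)) (symmetric_cubic a0 a1 a2) = 2 * (a2 * ?n ^ 2 * ?P3)"
      unfolding meval by simp
    \<comment> \<open>The contributions of \<open>m = 1\<close> and \<open>m = - 1\<close> from the
      cube are opposite, so the two values cannot both vanish. A nonzero \<open>m\<close> is
      required below, where summing the equations gives \<open>d * m * ?s = 0\<close>.\<close>
    ultimately have "meval (\<lambda>i. ?y i + 1) (symmetric_cubic a0 a1 a2) \<noteq> 0 \<or>
        meval (\<lambda>i. ?y i + (- 1)) (symmetric_cubic a0 a1 a2) \<noteq> 0"
      by (metis add_0 mult_eq_0_iff zero_neq_numeral)
    then obtain m where m: "m \<noteq> 0" "meval (\<lambda>i. ?y i + m) (symmetric_cubic a0 a1 a2) \<noteq> 0"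
      using that[of 1] that[of "- 1"] by force
    from m(2) show ?thesis
    proof (rule strong_lefschetz_nondegenerate)
      fix v i
      assume h: "\<And>i. hessian_apply a0 a1 a2 (\<lambda>i. ?y i + m) v i = 0"
      let ?q = "\<Sum>j\<in>UNIV. ?y j * v j" and ?s = "sum v UNIV"
      have h: "(d * m * ?s - a2 * ?q) - a2 * ?s * ?y i + a2 * ?n * (?y i * v i) = 0" for i
      proof -
        have 1: "(\<Sum>i\<in>UNIV. ?y i + m) = ?n * m" by (simp add: sum.distrib sum_balanced)
        have 2: "(\<Sum>j\<in>UNIV. (?y j + m) * v j) = ?q + m * ?s"
          by (simp add: distrib_right sum.distrib sum_distrib_left)
        have "6 * ?n * ((d * m * ?s - a2 * ?q) - a2 * ?s * ?y i + a2 * ?n * (?y i * v i)) = 0"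
          using h[of i] unfolding hessian_apply_def 1 2 a0 shifted(2)
          by (simp add: algebra_simps power2_eq_square)
        then show ?thesis using nz by simp
      qed
      have "(\<Sum>i\<in>UNIV. (d * m * ?s - a2 * ?q) - a2 * ?s * ?y i + a2 * ?n * (?y i * v i)) = 0"
        using h by simp
      then have "?n * (d * m * ?s) = 0"
        unfolding sum.distrib sum_subtractf sum_distrib_left[symmetric] sum_balanced
        by (simp add: algebra_simps)
      then have s: "?s = 0" using nz d m by simp
      have "?n * (?y i * v i) = ?q" for i
      proof -
        have "a2 * (?n * (?y i * v i) - ?q) = 0"
          using h[of i] unfolding s by (simp add: algebra_simps)
        then show ?thesis using shifted by simp
      qed
      then show "v i = 0" using balanced_eq_0[OF n s] by blast
    qed
  next
    case ones
    show ?thesis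
    \<comment> \<open>At the all-ones point the Hessian is a scalar matrix plus a multiple of the
      all-ones matrix, with eigenvalues proportional to \<open>a1\<close> and, on constants, to
      \<open>a0 + a1\<close>.\<close>
    proof (rule strong_lefschetz_nondegenerate[of "\<lambda>_. 1"])
      have "?n ^ 3 * (a0 + a1) \<noteq> 0" using nz ones by simp
      then show "meval (\<lambda>_. 1) (symmetric_cubic a0 a1 a2 :: ('n, 'k) mpol) \<noteq> 0"
        unfolding meval_symmetric_cubic by (simp add: ones algebra_simps power3_eq_cube)
      fix v :: "'n \<Rightarrow> 'k" and i
      assume h: "\<And>i. hessian_apply a0 a1 a2 (\<lambda>_. 1) v i = 0"
      let ?s = "sum v UNIV"
      have h: "(3 * a0 + 2 * a1) * ?s + a1 * ?n * v i = 0" for i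
      proof -
        have "2 * ?n * ((3 * a0 + 2 * a1) * ?s + a1 * ?n * v i) = 0"
          using h[of i] by (simp add: hessian_apply_def ones algebra_simps)
        then show ?thesis using nz by simp
      qed
      have "(\<Sum>i\<in>UNIV. (3 * a0 + 2 * a1) * ?s + a1 * ?n * v i) = 0" using h by simp
      then have "3 * ?n * (a0 + a1) * ?s = 0"
        unfolding sum.distrib sum_distrib_left[symmetric] by (simp add: algebra_simps)
      then have "?s = 0" using nz ones by simp
      then show "v i = 0" using h[of i] nz ones by simp
    qed
  next
    case unit
    \<comment> \<open>Here the cubic is \<open>a1 p_1 (n p_2 - p_1^2)\<close>, whose second factor
      vanishes at constant vectors; at a unit vector it equals \<open>n - 1\<close>.\<close>
    let ?e = "\<lambda>j::'n. of_bool (j = undefined) :: 'k"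
    have e: "sum ?e UNIV = 1" "(\<Sum>j\<in>UNIV. ?e j * v j) = v undefined" for v
      by (simp_all add: of_bool_def if_distrib if_distribR cong: if_cong)
    show ?thesis
    proof (rule strong_lefschetz_nondegenerate[of ?e])
      have e': "(\<Sum>j\<in>UNIV. ?e j ^ p) = 1" if "p > 0" for p
      proof -
        have "?e j ^ p = ?e j" for j using that by (cases "j = undefined") auto
        then show ?thesis using e(1) by simp
      qed
      have "a1 * (?n - 1) \<noteq> 0" using nz unit by simp
      then show "meval ?e (symmetric_cubic a0 a1 a2) \<noteq> 0"
        unfolding meval_symmetric_cubic e(1) e'[OF zero_less_numeral] by (simp add: unit algebra_simps)
      fix v :: "'n \<Rightarrow> 'k" and i
      assume h: "\<And>i. hessian_apply a0 a1 a2 ?e v i = 0"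
      let ?s = "sum v UNIV" and ?u = "v undefined"
      have h: "?n * ?u - 3 * ?s + ?n * ?s * ?e i + ?n * v i = 0" for i
      proof -
        have "2 * a1 * (?n * ?u - 3 * ?s + ?n * ?s * ?e i + ?n * v i) = 0"
          using h[of i] unfolding hessian_apply_def e by (simp add: unit algebra_simps)
        then show ?thesis using unit by simp
      qed
      have "(\<Sum>i\<in>UNIV. ?n * ?u - 3 * ?s + ?n * ?s * ?e i + ?n * v i) = 0" using h by simp
      then have "?n * (?n * ?u - ?s) = 0"
        unfolding sum.distrib sum_distrib_left[symmetric] e by (simp add: algebra_simps)
      then have s: "?s = ?n * ?u" using nz by simp
      have "?n * (?n - 1) * ?u = 0"
        using h[of undefined] unfolding s by (simp add: algebra_simps)
      then have u: "?u = 0" using nz by simp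
      show "v i = 0" using h[of i] s u nz by simp
    qed
  qed
qed

theorem proposition4p10:
  fixes a0 a1 a2 :: "'k::field_char_0"
    and F :: "('n::finite, 'k) mpol"
  assumes "CARD('n) \<ge> 3"
    and "F = mconst a0 * power_sum 1 ^ 3
           + mconst a1 * of_nat CARD('n) * power_sum 1 * power_sum 2
           + mconst a2 * of_nat CARD('n) ^ 2 * power_sum 3"
    and "F \<noteq> 0"
  shows "strong_lefschetz (ann F)"
proof -
  have F: "F = symmetric_cubic a0 a1 a2"
    unfolding symmetric_cubic_def by (rule assms(2))
  with assms(3) have "a0 \<noteq> 0 \<or> a1 \<noteq> 0 \<or> a2 \<noteq> 0"
    by (auto simp: symmetric_cubic_def mconst_0)
  with assms(1) show ?thesis unfolding F by (rule strong_lefschetz_symmetric_cubic)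
qed

end
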